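(* Let $S\subseteq\mathbb{N}$ be a $D$-set, let $p\in\mathbb{N}$, and let $\big(s^{(1)}_\alpha\big)_{\alpha\in\mathcal{F}},\ldots,\big(s^{(p)}_\alpha\big)_{\alpha\in\mathcal{F}}$ be $IP$-systems in $\mathbb{Z}$. Then there exist a sequence $a_1,a_2,\ldots$ in $\mathbb{N}$ and a sequence $\alpha_1<\alpha_2<\cdots$ in $\mathcal{F}$ such that for all $l\ge 1$, all $k_1<\cdots<k_l$ in $\mathbb{N}$ and all $i\in\{1,\ldots,p\}$, $$\big(a_{k_1}+s^{(i)}_{\alpha_{k_1}}\big)+\cdots+\big(a_{k_l}+s^{(i)}_{\alpha_{k_l}}\big)\in S.$$
   Context: $\mathbb{N}$ denotes the set of positive integers. $\mathcal{F}$ denotes the set of all finite nonempty subsets of $\mathbb{N}$. For $\alpha,\beta\in\mathcal{F}$, $\alpha<\beta$ means $\max\alpha<\min\beta$. Given a sequence $s_1,s_2,\ldots$ in $\mathbb{Z}$ and $\alpha=\{k_1,\ldots,k_l\}\in\mathcal{F}$ with $k_1<\cdots<k_l$, put $s_\alpha=s_{k_1}+\cdots+s_{k_l}$; the family $(s_\alpha)_{\alpha\in\mathcal{F}}$ is called an $IP$-system. Upper Banach density: for $S\subseteq\mathbb{N}$, $d^*(S)=\limsup_{(m-n)\to\infty}\frac{|S\cap\{n,\ldots,m\}|}{m-n+1}$. A dynamical system $(X,T)$ is a compact metric space $X$ together with a continuous transformation $T:X\to X$. The orbit closure of a point is the closure of its forward orbit $\{T^n x:n\in\mathbb{N}\}$.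 A point $y\in X$ is essentially recurrent if for every neighborhood $U$ of $y$ the set $\{n\in\mathbb{N}:T^ny\in U\}$ has positive upper Banach density. $D$-set: a set $S\subseteq\mathbb{N}$ is a $D$-set iff there exist a dynamical system $(X,T)$, points $x,y\in X$ such that $y$ is essentially recurrent and $(y,y)$ belongs to the orbit closure of $(x,y)$ in the product system $(X\times X,T\times T)$, and an open neighborhood $U$ of $(y,y)$ in $X\times X$ such that $S=\{n\in\mathbb{N}:(T^nx,T^ny)\in U\}$. *)

theory Defs
  imports "HOL-Analysis.Analysis"
begin

text \<open>
  The set of positive integers is rendered as \<open>{1..} :: nat set\<close>; all sequences are indexed by
  positive integers, so their value at 0 is never used.
\<close>

definition fin_sets :: "nat set set" where
  "fin_sets = {\<alpha>. finite \<alpha> \<and> \<alpha> \<noteq> {} \<and> \<alpha> \<subseteq> {1..}}"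

definition set_less :: "nat set \<Rightarrow> nat set \<Rightarrow> bool" (infix "\<lless>" 50) where
  "\<alpha> \<lless> \<beta> \<longleftrightarrow> Max \<alpha> < Min \<beta>"

definition ip_system :: "(nat set \<Rightarrow> int) \<Rightarrow> bool" where
  "ip_system s \<longleftrightarrow> (\<exists>t :: nat \<Rightarrow> int. \<forall>\<alpha>\<in>fin_sets. s \<alpha> = (\<Sum>k\<in>\<alpha>. t k))"

text \<open>
  The filter below on pairs \<open>(n, m)\<close> with \<open>n \<ge> 1\<close> expresses that \<open>m - n\<close> tends to infinity. The
  subtraction is truncated, but \<open>m - n \<ge> N > 0\<close> forces \<open>n < m\<close>, so the pairs with \<open>m < n\<close> are
  irrelevant.
\<close>

definition interval_length_filter :: "(nat \<times> nat) filter" where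
  "interval_length_filter =
     inf (filtercomap (\<lambda>(n, m). m - n) at_top) (principal {(n, m). 1 \<le> n})"

definition upper_banach_density :: "nat set \<Rightarrow> ereal" where
  "upper_banach_density S =
     Limsup interval_length_filter
       (\<lambda>(n, m). ereal (real (card (S \<inter> {n..m})) / (real m - real n + 1)))"

text \<open>
  A compact metric space is given as a compact subset \<open>X\<close> of a type of class \<^class>\<open>metric_space\<close>;
  all topological notions are taken relative to the subspace \<open>X\<close>.
\<close>

definition dynamical_system :: "'a::metric_space set \<Rightarrow> ('a \<Rightarrow> 'a) \<Rightarrow> bool" where
  "dynamical_system X T \<longleftrightarrow> compact X \<and> continuous_on X T \<and> T ` X \<subseteq> X"

definition orbit_closure :: "'a::topological_space set \<Rightarrow> ('a \<Rightarrow> 'a) \<Rightarrow> 'a \<Rightarrow> 'a set" where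
  "orbit_closure X T x = top_of_set X closure_of {(T ^^ n) x | n. n \<ge> 1}"

definition essentially_recurrent ::
  "'a::metric_space set \<Rightarrow> ('a \<Rightarrow> 'a) \<Rightarrow> 'a \<Rightarrow> bool" where
  "essentially_recurrent X T y \<longleftrightarrow>
     (\<forall>U \<subseteq> X. y \<in> top_of_set X interior_of U \<longrightarrow>
        upper_banach_density {n. n \<ge> 1 \<and> (T ^^ n) y \<in> U} > 0)"

text \<open>
  HOL has no existential quantification over types, so the type hosting the system is a parameter.
  As a hypothesis with a free type variable, \<open>D_set TYPE('a) S\<close> ranges over all host types, which
  amounts to assuming the existence of a system on some type.
\<close>

definition D_set :: "'a::metric_space itself \<Rightarrow> nat set \<Rightarrow> bool" where
  "D_set (_ :: 'a itself) S \<longleftrightarrow>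
     (\<exists>(X :: 'a set) T x y U.
        dynamical_system X T \<and> x \<in> X \<and> y \<in> X \<and>
        essentially_recurrent X T y \<and>
        (y, y) \<in> orbit_closure (X \<times> X) (map_prod T T) (x, y) \<and>
        openin (top_of_set (X \<times> X)) U \<and> (y, y) \<in> U \<and>
        S = {n. n \<ge> 1 \<and> ((T ^^ n) x, (T ^^ n) y) \<in> U})"

end

theory Submission
  imports Defs
begin

text \<open>
  A family of integer sequences turns a word over \<open>{1..p}\<close> into an integer so that combinatorial lines
  become configurations \<open>a + s i \<alpha>\<close>; hence the density Hales--Jewett theorem yields, in the set of return
  times of the essentially recurrent point \<open>y\<close> to a neighbourhood, values of \<open>a\<close> and \<open>\<alpha>\<close> (beyond any
  bound) with \<open>a + s i \<alpha>\<close> in this set for all \<open>i\<close>. Finitely many return conditions at \<open>y\<close> persist near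
  \<open>y\<close>, and the orbit of \<open>(x, y)\<close> comes arbitrarily close to \<open>(y, y)\<close>, so after a further shift of \<open>a\<close> the
  same times work for \<open>x\<close> and \<open>y\<close> together. Shrinking the neighbourhood at each step so that all sums
  found earlier map it into the original one produces the two sequences.

  The density Hales--Jewett theorem is proved by induction on the alphabet, by a density increment
  argument with uniform measures in the spirit of Polymath and of Dodos, Kanellopoulos and Tyros.
\<close>

section \<open>Cubes and averaging over fibres\<close>

text \<open>A uniformly random word over \<open>insert z K\<close>, read as a line over
  \<open>K\<close>, has points in which one letter is too frequent, so densities cannot simply be
  averaged over such lines. The usual remedy is a second, non-uniform measure (equal slices). Here
  the lines come from \<open>DHJ K\<close> in a bounded cube embedded at random, and symbols are
  duplicated so that conditioning on the positions of a balanced set \<open>Z\<close> of symbols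
  gives back the uniform measure.

  The increment is not iterated: at the critical density a nearly extremal line-free set has almost
  the same density on all fibres over boundedly many coordinates, so a deficit on one fibre is
  already contradictory.

  The partition of insensitive sets into subspaces appears as an inequality for functions whose sum
  over every \<open>M\<close>-dimensional subspace is nonpositive; in this form it passes from one
  letter of \<open>K\<close> to all of them.\<close>

abbreviation cube :: "'i set \<Rightarrow> 'a set \<Rightarrow> ('i \<Rightarrow> 'a) set" where
  "cube I K \<equiv> PiE I (\<lambda>_. K)"

text \<open>One function serves three purposes: it glues the two parts of a fibre decomposition,
  \<open>mrg S (\<lambda>_. a) x\<close> is the point with parameter \<open>a\<close> on the line
  with active coordinates \<open>S\<close>, and for \<open>S = {i \<in> I. u i = z}\<close> it
  overwrites the letter \<open>z\<close> in \<open>u\<close>.\<close>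

definition mrg :: "'i set \<Rightarrow> ('i \<Rightarrow> 'a) \<Rightarrow> ('i \<Rightarrow> 'a) \<Rightarrow> 'i \<Rightarrow> 'a" where
  "mrg J x y = (\<lambda>i. if i \<in> J then x i else y i)"

lemma finite_cube: "finite I \<Longrightarrow> finite K \<Longrightarrow> finite (cube I K)"
  by (simp add: finite_PiE)

lemma card_cube: "finite I \<Longrightarrow> real (card (cube I K)) = real (card K) ^ card I"
  by (simp add: card_PiE)

lemma mrg_in_cube:
  "J \<subseteq> I \<Longrightarrow> x \<in> cube J K \<Longrightarrow> y \<in> cube (I - J) K \<Longrightarrow> mrg J x y \<in> cube I K"
  by (auto simp: mrg_def PiE_iff extensional_def)

lemma mrg_commute:
  "J \<subseteq> I \<Longrightarrow> x \<in> cube J K \<Longrightarrow> y \<in> cube (I - J) K \<Longrightarrow> mrg J x y = mrg (I - J) y x"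
  by (auto simp: mrg_def PiE_iff extensional_def fun_eq_iff)

lemma bij_betw_mrg:
  assumes "J \<subseteq> I"
  shows "bij_betw (\<lambda>(x, y). mrg J x y) (cube J K \<times> cube (I - J) K) (cube I K)"
proof (rule bij_betw_byWitness[where f' = "\<lambda>w. (restrict w J, restrict w (I - J))"])
  show "\<forall>p\<in>cube J K \<times> cube (I - J) K.
      (restrict (case p of (x, y) \<Rightarrow> mrg J x y) J,
       restrict (case p of (x, y) \<Rightarrow> mrg J x y) (I - J)) = p"
    by (auto simp: mrg_def PiE_iff extensional_def fun_eq_iff restrict_def)
  show "\<forall>w\<in>cube I K. (case (restrict w J, restrict w (I - J)) of (x, y) \<Rightarrow> mrg J x y) = w"
    using assms by (auto simp: mrg_def PiE_iff extensional_def fun_eq_iff restrict_def)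
  show "(\<lambda>(x, y). mrg J x y) ` (cube J K \<times> cube (I - J) K) \<subseteq> cube I K"
    using mrg_in_cube[OF assms, of _ K] by (intro image_subsetI) (simp only: mem_Times_iff case_prod_beta)
  show "(\<lambda>w. (restrict w J, restrict w (I - J))) ` cube I K \<subseteq> cube J K \<times> cube (I - J) K"
    using assms by (auto simp: PiE_iff)
qed

lemma sum_cube_split:
  fixes F :: "('i \<Rightarrow> 'a) \<Rightarrow> real"
  assumes "J \<subseteq> I"
  shows "(\<Sum>w\<in>cube I K. F w) = (\<Sum>x\<in>cube J K. \<Sum>y\<in>cube (I - J) K. F (mrg J x y))"
proof -
  have "(\<Sum>w\<in>cube I K. F w) = (\<Sum>p\<in>cube J K \<times> cube (I - J) K. F ((\<lambda>(x, y). mrg J x y) p))"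
    by (rule sum.reindex_bij_betw[OF bij_betw_mrg[OF assms], symmetric])
  then show ?thesis
    by (simp add: sum.cartesian_product case_prod_beta)
qed

lemma card_eq_sum_of_bool: "finite B \<Longrightarrow> A \<subseteq> B \<Longrightarrow> real (card A) = (\<Sum>x\<in>B. of_bool (x \<in> A))"
  by (simp add: Int_absorb1)

lemma card_Collect_eq_sum_of_bool:
  "finite B \<Longrightarrow> real (card {x \<in> B. P x}) = (\<Sum>x\<in>B. of_bool (P x))"
  by (simp add: Int_def)

lemma card_cube_fibres:
  assumes "J \<subseteq> I" "finite I" "finite K" "A \<subseteq> cube I K"
  shows "real (card A) = (\<Sum>x\<in>cube J K. real (card {y \<in> cube (I - J) K. mrg J x y \<in> A}))"
    and "real (card A) = (\<Sum>y\<in>cube (I - J) K. real (card {x \<in> cube J K. mrg J x y \<in> A}))"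
proof -
  have fin: "finite (cube I K)" "finite (cube J K)" "finite (cube (I - J) K)"
    using assms by (auto intro!: finite_cube intro: finite_subset)
  have *: "real (card A) = (\<Sum>x\<in>cube J K. \<Sum>y\<in>cube (I - J) K. of_bool (mrg J x y \<in> A))"
    unfolding card_eq_sum_of_bool[OF fin(1) assms(4)] by (rule sum_cube_split[OF assms(1)])
  show "real (card A) = (\<Sum>x\<in>cube J K. real (card {y \<in> cube (I - J) K. mrg J x y \<in> A}))"
    unfolding * card_Collect_eq_sum_of_bool[OF fin(3)] ..
  show "real (card A) = (\<Sum>y\<in>cube (I - J) K. real (card {x \<in> cube J K. mrg J x y \<in> A}))"
    unfolding * card_Collect_eq_sum_of_bool[OF fin(2)] by (rule sum.swap)
qed

lemma card_cube_split:
  assumes "J \<subseteq> I" "finite I"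
  shows "real (card K) ^ card I = real (card K) ^ card J * real (card K) ^ card (I - J)"
  using assms
  by (metis card_Diff_subset card_mono finite_subset le_add_diff_inverse power_add)

text \<open>Reverse Markov inequality: values below the threshold add up to at most half of the
  required total, and every other value is at most \<open>c\<close>.\<close>

lemma card_ge_half:
  fixes g :: "'a \<Rightarrow> real" and c \<eta> :: real
  assumes "finite Y" "\<And>y. y \<in> Y \<Longrightarrow> g y \<le> c" "c * (\<eta> * card Y) \<le> sum g Y" "0 \<le> \<eta>" "0 < c"
  shows "\<eta> / 2 * card Y \<le> card {y \<in> Y. \<eta> / 2 * c \<le> g y}"
proof -
  let ?G = "{y \<in> Y. \<eta> / 2 * c \<le> g y}"
  have "sum g Y \<le> (\<Sum>y\<in>Y. c * of_bool (y \<in> ?G) + \<eta> / 2 * c)"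
    using assms by (intro sum_mono) (auto simp: not_le add_increasing2)
  also have "\<dots> = c * (card ?G + \<eta> / 2 * card Y)"
    using assms(1) by (simp add: sum.distrib Int_def algebra_simps flip: sum_distrib_left)
  finally have "c * (\<eta> * card Y) \<le> c * (card ?G + \<eta> / 2 * card Y)"
    using assms(3) by linarith
  then have "\<eta> * card Y \<le> card ?G + \<eta> / 2 * card Y"
    using assms(5) by simp
  then show ?thesis by simp
qed

text \<open>An exponential moment bound: \<open>2 ^ d\<close> times a factor 1/2 for each position
  with a letter in \<open>Z\<close> is at least 1 on the words counted, and its sum over the cube
  factorises over the positions.\<close>

lemma card_few_hits:
  assumes "finite I" "finite \<Sigma>" "Z \<subseteq> \<Sigma>" "Z \<noteq> {}"
  shows "card {b \<in> cube I \<Sigma>. card {i \<in> I. b i \<in> Z} < d} \<le> 2 ^ d * (card \<Sigma> - 1/2 :: real) ^ card I"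
proof -
  let ?B = "{b \<in> cube I \<Sigma>. card {i \<in> I. b i \<in> Z} < d}"
  have fin: "finite (cube I \<Sigma>)" using assms by (simp add: finite_cube)
  have fZ: "finite Z" "1 \<le> card Z" using assms finite_subset by (auto simp: Suc_le_eq card_gt_0_iff)
  have p: "(\<Prod>i\<in>I. if b i \<in> Z then 1/2 else 1) = (1/2::real) ^ card {i \<in> I. b i \<in> Z}" for b
    using assms(1) by (simp add: prod.If_cases Int_def)
  have "real (card ?B) = (\<Sum>b\<in>?B. 1)" by simp
  also have "\<dots> \<le> (\<Sum>b\<in>?B. 2 ^ d * (\<Prod>i\<in>I. if b i \<in> Z then 1/2 else 1))"
  proof (rule sum_mono)
    fix b assume "b \<in> ?B"
    then have "(1/2::real) ^ d \<le> (1/2) ^ card {i \<in> I. b i \<in> Z}"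
      by (intro power_decreasing) auto
    then show "1 \<le> 2 ^ d * (\<Prod>i\<in>I. if b i \<in> Z then 1/2 else 1::real)"
      unfolding p by (simp add: field_simps power_divide)
  qed
  also have "\<dots> \<le> (\<Sum>b\<in>cube I \<Sigma>. 2 ^ d * (\<Prod>i\<in>I. if b i \<in> Z then 1/2 else 1))"
    using fin by (intro sum_mono2) (simp_all add: prod_nonneg)
  also have "\<dots> = 2 ^ d * (\<Prod>i\<in>I. \<Sum>s\<in>\<Sigma>. if s \<in> Z then 1/2 else 1)"
    unfolding sum_distrib_left[symmetric]
    by (subst prod_sum_PiE) (use assms in simp_all)
  also have "(\<Sum>s\<in>\<Sigma>. if s \<in> Z then 1/2 else 1) = card \<Sigma> - card Z / 2"
  proof -
    have "(\<Sum>s\<in>\<Sigma>. if s \<in> Z then 1/2 else 1) = (\<Sum>s\<in>\<Sigma>. 1 - 1/2 * of_bool (s \<in> Z) :: real)"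
      by (intro sum.cong) auto
    also have "\<dots> = card \<Sigma> - card Z / 2"
      using assms by (simp add: sum_subtractf Int_absorb1 flip: sum_divide_distrib)
    finally show ?thesis .
  qed
  also have "2 ^ d * (\<Prod>i\<in>I. card \<Sigma> - card Z / 2) \<le> 2 ^ d * (card \<Sigma> - 1/2 :: real) ^ card I"
    using fZ card_mono[OF assms(2,3)] by (auto intro!: power_mono)
  finally show ?thesis .
qed

text \<open>\<open>N\<close> is uniform in \<open>Z\<close>, because the preceding bound depends on
  \<open>Z\<close> only through \<open>Z \<noteq> {}\<close>.\<close>

lemma few_hits_rare:
  assumes "finite \<Sigma>" "0 < \<theta>"
  shows "\<exists>N. \<forall>I Z. finite (I::'i set) \<and> N \<le> card I \<and> Z \<subseteq> \<Sigma> \<and> Z \<noteq> {} \<longrightarrow>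
    card {b \<in> cube I \<Sigma>. card {i \<in> I. b i \<in> Z} < d} < \<theta> * real (card \<Sigma>) ^ card I"
proof (cases "\<Sigma> = {}")
  case False
  define c where "c = real (card \<Sigma>)"
  have c: "c \<ge> 1" using False assms by (simp add: c_def Suc_le_eq card_gt_0_iff)
  define r where "r = 1 - 1 / (2 * c)"
  have r: "0 \<le> r" "r < 1" using c by (auto simp: r_def field_simps)
  have "(\<lambda>n. 2 ^ d * r ^ n) \<longlonglongrightarrow> 2 ^ d * 0"
    using r by (intro tendsto_intros LIMSEQ_power_zero) auto
  then have "eventually (\<lambda>n. 2 ^ d * r ^ n < \<theta>) sequentially"
    by (rule order_tendstoD(2)) (use assms in simp)
  then obtain N where N: "\<And>n. N \<le> n \<Longrightarrow> 2 ^ d * r ^ n < \<theta>"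
    by (auto simp: eventually_sequentially)
  show ?thesis
  proof (intro exI allI impI)
    fix I :: "'i set" and Z assume *: "finite I \<and> N \<le> card I \<and> Z \<subseteq> \<Sigma> \<and> Z \<noteq> {}"
    have "card {b \<in> cube I \<Sigma>. card {i \<in> I. b i \<in> Z} < d} \<le> 2 ^ d * (c - 1/2) ^ card I"
      using card_few_hits[of I \<Sigma> Z d] * assms by (simp add: c_def)
    also have "c - 1/2 = r * c" using c by (simp add: r_def field_simps)
    also have "2 ^ d * (r * c) ^ card I = (2 ^ d * r ^ card I) * c ^ card I"
      by (simp add: power_mult_distrib)
    also have "\<dots> < \<theta> * c ^ card I"
      using N[of "card I"] * c by (intro mult_strict_right_mono) auto
    finally show "card {b \<in> cube I \<Sigma>. card {i \<in> I. b i \<in> Z} < d} < \<theta> * real (card \<Sigma>) ^ card I"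
      by (simp add: c_def)
  qed
qed (use assms in auto)

text \<open>A letter map all of whose fibres have \<open>r\<close> elements carries the uniform
  distribution on \<open>cube J Z\<close> to the uniform one on \<open>cube J K\<close>: each word
  has \<open>r ^ card J\<close> preimages.\<close>

lemma sum_cube_map:
  fixes h :: "('i \<Rightarrow> 'b) \<Rightarrow> real"
  assumes "finite J" "finite Z" "finite K" "\<rho> ` Z \<subseteq> K"
    and "\<And>a. a \<in> K \<Longrightarrow> card {s \<in> Z. \<rho> s = a} = r"
  shows "(\<Sum>b\<in>cube J Z. h (\<lambda>i\<in>J. \<rho> (b i))) = real r ^ card J * (\<Sum>u\<in>cube J K. h u)"
proof -
  let ?g = "\<lambda>b. \<lambda>i\<in>J. \<rho> (b i)"
  have "(\<Sum>b\<in>cube J Z. h (?g b)) = (\<Sum>u\<in>cube J K. \<Sum>b\<in>{b \<in> cube J Z. ?g b = u}. h (?g b))"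
    using assms(1-4)
    by (intro sum.group[symmetric] finite_cube) (auto simp: PiE_iff image_subset_iff)
  also have "\<dots> = (\<Sum>u\<in>cube J K. real r ^ card J * h u)"
  proof (rule sum.cong)
    fix u assume u: "u \<in> cube J K"
    have "{b \<in> cube J Z. ?g b = u} = PiE J (\<lambda>i. {s \<in> Z. \<rho> s = u i})"
      using u by (auto simp: PiE_iff extensional_def fun_eq_iff restrict_def) 
    moreover have "card (PiE J (\<lambda>i. {s \<in> Z. \<rho> s = u i})) = r ^ card J"
      using assms u by (subst card_PiE) (auto simp: PiE_iff)
    ultimately have "card {b \<in> cube J Z. ?g b = u} = r ^ card J" by simp
    then show "(\<Sum>b\<in>{b \<in> cube J Z. ?g b = u}. h (?g b)) = real r ^ card J * h u"
      by simp
  qed simp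
  finally show ?thesis by (simp add: sum_distrib_left)
qed

text \<open>The words are grouped by the positions of their \<open>Z\<close>-letters and by the
  letters elsewhere; each group is a copy of some \<open>cube J Z\<close>. Groups with fewer than
  \<open>d\<close> active positions carry less than \<theta> of the mass, so if the average on all
  others were at most \<theta>, the total would stay below \<open>2 * \<theta>\<close>.\<close>

lemma exists_dense_fibre:
  fixes F :: "('i \<Rightarrow> 's) \<Rightarrow> real"
  assumes fin: "finite I" "finite \<Sigma>" and Z: "Z \<subseteq> \<Sigma>"
    and F: "\<And>b. b \<in> cube I \<Sigma> \<Longrightarrow> F b \<le> 1"
    and rare: "card {b \<in> cube I \<Sigma>. card {i \<in> I. b i \<in> Z} < d} < \<theta> * real (card \<Sigma>) ^ card I"
    and avg: "2 * \<theta> * real (card \<Sigma>) ^ card I \<le> (\<Sum>b\<in>cube I \<Sigma>. F b)"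
    and \<theta>: "0 \<le> \<theta>"
  shows "\<exists>J c. J \<subseteq> I \<and> d \<le> card J \<and> c \<in> cube (I - J) (\<Sigma> - Z) \<and>
           \<theta> * real (card Z) ^ card J \<le> (\<Sum>b\<in>cube J Z. F (mrg J b c))"
proof (rule ccontr)
  assume "\<not> ?thesis"
  then have small: "(\<Sum>b\<in>cube J Z. F (mrg J b c)) \<le> \<theta> * real (card Z) ^ card J"
    if "J \<subseteq> I" "d \<le> card J" "c \<in> cube (I - J) (\<Sigma> - Z)" for J c
    using that by (meson linear)
  define act where "act b = {i \<in> I. b i \<in> Z}" for b :: "'i \<Rightarrow> 's"
  define key where "key b = (act b, restrict b (I - act b))" for b :: "'i \<Rightarrow> 's"
  define C where "C = cube I \<Sigma>"
  have finC: "finite C" using fin by (simp add: C_def finite_cube)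
  let ?S = "{b \<in> C. card (act b) < d}" and ?L = "{b \<in> C. d \<le> card (act b)}"
  have "(\<Sum>b\<in>?L. F b) = (\<Sum>k\<in>key ` ?L. \<Sum>b\<in>{b \<in> ?L. key b = k}. F b)"
    using finC by (intro sum.group[symmetric]) auto
  also have "\<dots> \<le> (\<Sum>k\<in>key ` ?L. \<Sum>b\<in>{b \<in> ?L. key b = k}. \<theta>)"
  proof (rule sum_mono)
    fix k assume "k \<in> key ` ?L"
    then obtain b0 where b0: "b0 \<in> C" "d \<le> card (act b0)" "k = key b0" by auto
    define J where "J = act b0"
    define c where "c = restrict b0 (I - J)"
    have J: "J \<subseteq> I" "d \<le> card J" using b0 by (auto simp: J_def act_def)
    have c: "c \<in> cube (I - J) (\<Sigma> - Z)"
      using b0 by (auto simp: J_def act_def c_def C_def PiE_iff)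
    have actm: "act (mrg J x c) = J" if "x \<in> cube J Z" for x
      using that J c by (auto simp: act_def mrg_def PiE_iff)
    have eq: "{b \<in> ?L. key b = k} = (\<lambda>x. mrg J x c) ` cube J Z"
    proof (intro equalityI subsetI)
      fix b assume b: "b \<in> {b \<in> ?L. key b = k}"
      then have k: "act b = J" "restrict b (I - J) = c"
        by (auto simp: b0 key_def J_def c_def)
      have "b = mrg J (restrict b J) c"
        using b J unfolding k(2)[symmetric]
        by (auto simp: fun_eq_iff mrg_def restrict_def C_def PiE_iff extensional_def)
      moreover have "restrict b J \<in> cube J Z" using k(1) by (auto simp: act_def)
      ultimately show "b \<in> (\<lambda>x. mrg J x c) ` cube J Z" by blast
    next
      fix b assume "b \<in> (\<lambda>x. mrg J x c) ` cube J Z"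
      then obtain x where x: "x \<in> cube J Z" "b = mrg J x c" by auto
      have "x \<in> cube J \<Sigma>" "c \<in> cube (I - J) \<Sigma>" using x c Z by (auto simp: PiE_iff)
      then have "b \<in> C" using mrg_in_cube[OF J(1)] x by (simp add: C_def)
      moreover have "restrict b (I - J) = c"
        using c x by (auto simp: fun_eq_iff mrg_def restrict_def PiE_iff extensional_def)
      ultimately show "b \<in> {b \<in> ?L. key b = k}"
        using actm[OF x(1)] x J b0 by (simp add: key_def J_def[symmetric] c_def)
    qed
    have inj: "inj_on (\<lambda>x. mrg J x c) (cube J Z)"
    proof (rule inj_onI)
      fix x y assume "x \<in> cube J Z" "y \<in> cube J Z" "mrg J x c = mrg J y c"
      then show "x = y" by (auto simp: mrg_def fun_eq_iff PiE_iff extensional_def) metis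
    qed
    have "finite J" using J fin finite_subset by auto
    then have "card (cube J Z) = card Z ^ card J" by (simp add: card_PiE)
    then show "(\<Sum>b\<in>{b \<in> ?L. key b = k}. F b) \<le> (\<Sum>b\<in>{b \<in> ?L. key b = k}. \<theta>)"
      unfolding eq using small[OF J c] inj by (simp add: sum.reindex card_image mult.commute)
  qed
  also have "\<dots> = (\<Sum>b\<in>?L. \<theta>)"
    using finC by (intro sum.group) auto
  also have "\<dots> \<le> \<theta> * real (card \<Sigma>) ^ card I"
  proof -
    have "real (card ?L) \<le> real (card C)" using finC by (simp add: card_mono)
    then show ?thesis
      using \<theta> fin by (simp add: C_def card_cube mult_left_mono mult.commute del: card_PiE)
  qed
  finally have 1: "(\<Sum>b\<in>?L. F b) \<le> \<theta> * real (card \<Sigma>) ^ card I" .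
  have "(\<Sum>b\<in>?S. F b) \<le> (\<Sum>b\<in>?S. 1)"
    using F by (intro sum_mono) (auto simp: C_def)
  also have "\<dots> = card {b \<in> cube I \<Sigma>. card {i \<in> I. b i \<in> Z} < d}"
    by (simp add: C_def act_def)
  finally have 2: "(\<Sum>b\<in>?S. F b) < \<theta> * real (card \<Sigma>) ^ card I"
    using rare by linarith
  have "(\<Sum>b\<in>C. F b) = (\<Sum>b\<in>?L. F b) + (\<Sum>b\<in>?S. F b)"
    using finC by (subst sum.union_disjoint[symmetric]) (auto intro!: sum.cong)
  with 1 2 avg show False by (simp add: C_def)
qed

section \<open>Lines, subspaces and insensitive sets\<close>

text \<open>The template \<open>x\<close> is not confined to the cube: its values on
  \<open>S\<close> are overwritten, and off \<open>S\<close> they are restricted by the points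
  having to lie in \<open>A\<close>.\<close>

definition has_line :: "'a set \<Rightarrow> nat set \<Rightarrow> (nat \<Rightarrow> 'a) set \<Rightarrow> bool" where
  "has_line K I A \<longleftrightarrow> (\<exists>S x. S \<subseteq> I \<and> S \<noteq> {} \<and> (\<forall>a\<in>K. mrg S (\<lambda>_. a) x \<in> A))"

text \<open>Arbitrary finite index sets, instead of initial segments, make fibres over a set of
  coordinates instances of the same statement without renumbering.\<close>

definition DHJ :: "'a set \<Rightarrow> bool" where
  "DHJ K \<longleftrightarrow> (\<forall>\<delta>>0. \<exists>N. \<forall>I A. finite I \<and> N \<le> card I \<and> A \<subseteq> cube I K \<and>
     \<delta> * real (card K) ^ card I \<le> card A \<longrightarrow> has_line K I A)"

text \<open>These are the insensitive sets known from Shelah's proof of the Hales--Jewett theorem.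
  Their virtue is that a line over \<open>K\<close> inside one extends to a line over
  \<open>insert z K\<close>.\<close>

definition insensitive :: "'a \<Rightarrow> 'a \<Rightarrow> 'a set \<Rightarrow> nat set \<Rightarrow> (nat \<Rightarrow> 'a) set \<Rightarrow> bool" where
  "insensitive a z K I D \<longleftrightarrow> D \<subseteq> cube I K \<and>
     (\<forall>x\<in>D. \<forall>y\<in>cube I K. (\<forall>i\<in>I. x i = y i \<or> x i \<in> {a, z} \<and> y i \<in> {a, z}) \<longrightarrow> y \<in> D)"

text \<open>
  An \<open>M\<close>-dimensional combinatorial subspace of \<open>cube I K\<close> is the image of \<open>cube {..<M} K\<close> under
  \<open>subst I w\<close>, where \<open>w i\<close> is either a fixed letter or a variable and every variable is used.
\<close>

definition subst :: "nat set \<Rightarrow> (nat \<Rightarrow> 'a + nat) \<Rightarrow> (nat \<Rightarrow> 'a) \<Rightarrow> nat \<Rightarrow> 'a" where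
  "subst I w x = (\<lambda>i\<in>I. case_sum id x (w i))"

definition subspace_word :: "'a set \<Rightarrow> nat set \<Rightarrow> nat set \<Rightarrow> (nat \<Rightarrow> 'a + nat) \<Rightarrow> bool" where
  "subspace_word K J I w \<longleftrightarrow> w ` I \<subseteq> Inl ` K \<union> Inr ` J \<and> Inr ` J \<subseteq> w ` I"

section \<open>Behaviour of lines and insensitive sets under fibres and substitution\<close>

lemma has_line_fibre:
  assumes "has_line K J {u \<in> cube J K. mrg J u y \<in> A}" "J \<subseteq> I"
  shows "has_line K I A"
proof -
  obtain S x where S: "S \<subseteq> J" "S \<noteq> {}" "\<And>a. a \<in> K \<Longrightarrow> mrg J (mrg S (\<lambda>_. a) x) y \<in> A"
    using assms unfolding has_line_def by blast
  have "mrg J (mrg S (\<lambda>_. a) x) y = mrg S (\<lambda>_. a) (mrg J x y)" for a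
    using S(1) by (auto simp: mrg_def fun_eq_iff)
  then show ?thesis unfolding has_line_def using S assms(2)
    by (intro exI[of _ S] exI[of _ "mrg J x y"]) auto
qed

lemma subst_in_cube: "subspace_word K J I w \<Longrightarrow> x \<in> cube J K \<Longrightarrow> subst I w x \<in> cube I K"
  by (fastforce simp: subst_def subspace_word_def PiE_iff)

lemma inj_on_subst: "subspace_word K J I w \<Longrightarrow> inj_on (subst I w) (cube J K)"
proof (rule inj_onI)
  fix x y assume *: "subspace_word K J I w" "x \<in> cube J K" "y \<in> cube J K" "subst I w x = subst I w y"
  show "x = y"
  proof
    fix j
    show "x j = y j"
    proof (cases "j \<in> J")
      case True
      then obtain i where i: "i \<in> I" "w i = Inr j" using *(1) unfolding subspace_word_def by force
      then show ?thesis using fun_cong[OF *(4), of i] by (simp add: subst_def)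
    qed (use * in \<open>auto simp: PiE_iff extensional_def\<close>)
  qed
qed

lemma subspace_word_mrg:
  assumes "I1 \<subseteq> I" "subspace_word K J1 I1 w1" "subspace_word K J2 (I - I1) w2"
  shows "subspace_word K (J1 \<union> J2) I (mrg I1 w1 w2)"
proof -
  have "mrg I1 w1 w2 ` I = w1 ` I1 \<union> w2 ` (I - I1)"
    using assms(1) by (auto simp: mrg_def image_iff)
  then show ?thesis using assms by (auto simp: subspace_word_def)
qed

lemma subspace_word_const: "x \<in> cube I K \<Longrightarrow> subspace_word K {} I (\<lambda>i. Inl (x i))"
  by (auto simp: subspace_word_def PiE_iff)

lemma subst_mrg:
  "I1 \<subseteq> I \<Longrightarrow> subst I (mrg I1 w1 w2) u = mrg I1 (subst I1 w1 u) (subst (I - I1) w2 u)"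
  by (auto simp: subst_def mrg_def fun_eq_iff)

lemma subst_const: "x \<in> cube I K \<Longrightarrow> subst I (\<lambda>i. Inl (x i)) u = x"
  by (auto simp: subst_def fun_eq_iff PiE_iff extensional_def)

lemma subst_subst:
  assumes "subspace_word K J I w"
  shows "subst I w (subst J v u) = subst I (\<lambda>i. case_sum Inl v (w i)) u"
proof
  fix i show "subst I w (subst J v u) i = subst I (\<lambda>i. case_sum Inl v (w i)) u i"
  proof (cases "i \<in> I")
    case True
    then have "w i \<in> Inl ` K \<union> Inr ` J" using assms by (auto simp: subspace_word_def)
    then show ?thesis using True by (auto simp: subst_def)
  qed (simp add: subst_def)
qed

lemma subspace_word_subst:
  assumes "subspace_word K J I w" "subspace_word K L J v"
  shows "subspace_word K L I (\<lambda>i. case_sum Inl v (w i))"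
  unfolding subspace_word_def
proof
  show "(\<lambda>i. case_sum Inl v (w i)) ` I \<subseteq> Inl ` K \<union> Inr ` L"
  proof (rule image_subsetI)
    fix i assume "i \<in> I"
    then have "w i \<in> Inl ` K \<union> Inr ` J" using assms by (auto simp: subspace_word_def)
    then show "case_sum Inl v (w i) \<in> Inl ` K \<union> Inr ` L"
      using assms(2) by (auto simp: subspace_word_def)
  qed
  show "Inr ` L \<subseteq> (\<lambda>i. case_sum Inl v (w i)) ` I"
  proof
    fix l assume "l \<in> (Inr ` L :: ('a + nat) set)"
    then obtain j where j: "j \<in> J" "l = v j" using assms(2) by (auto simp: subspace_word_def)
    have "Inr j \<in> w ` I" using assms(1) j by (auto simp: subspace_word_def)
    then obtain i where "i \<in> I" "w i = Inr j" by (metis imageE)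
    then show "l \<in> (\<lambda>i. case_sum Inl v (w i)) ` I" using j by (auto simp: image_iff intro!: bexI[of _ i])
  qed
qed

lemma insensitive_subst:
  assumes "insensitive a z K I D" "subspace_word K J I w"
  shows "insensitive a z K J {u \<in> cube J K. subst I w u \<in> D}"
  unfolding insensitive_def
proof (intro conjI ballI impI)
  fix x y assume *: "x \<in> {u \<in> cube J K. subst I w u \<in> D}" "y \<in> cube J K"
    "\<forall>i\<in>J. x i = y i \<or> x i \<in> {a, z} \<and> y i \<in> {a, z}"
  have "subst I w x i = subst I w y i \<or> subst I w x i \<in> {a, z} \<and> subst I w y i \<in> {a, z}"
    if "i \<in> I" for i
  proof -
    have "w i \<in> Inl ` K \<union> Inr ` J" using assms that by (auto simp: subspace_word_def)
    then show ?thesis using that * by (auto simp: subst_def)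
  qed
  then have "subst I w y \<in> D"
    using assms * subst_in_cube[OF assms(2) *(2)] unfolding insensitive_def by blast
  then show "y \<in> {u \<in> cube J K. subst I w u \<in> D}" using * by simp
qed auto

lemma insensitive_fibre:
  assumes "insensitive a z K I D" "J \<subseteq> I" "y \<in> cube J K"
  shows "insensitive a z K (I - J) {u \<in> cube (I - J) K. mrg J y u \<in> D}"
  unfolding insensitive_def
proof (intro conjI ballI impI)
  fix x x' assume *: "x \<in> {u \<in> cube (I - J) K. mrg J y u \<in> D}" "x' \<in> cube (I - J) K"
    "\<forall>i\<in>I - J. x i = x' i \<or> x i \<in> {a, z} \<and> x' i \<in> {a, z}"
  have "mrg J y x i = mrg J y x' i \<or> mrg J y x i \<in> {a, z} \<and> mrg J y x' i \<in> {a, z}"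
    if "i \<in> I" for i
    using that * by (auto simp: mrg_def)
  then have "mrg J y x' \<in> D"
    using assms * mrg_in_cube[OF assms(2,3) *(2)] unfolding insensitive_def by blast
  then show "x' \<in> {u \<in> cube (I - J) K. mrg J y u \<in> D}" using * by simp
qed auto

lemma insensitive_INT:
  assumes "\<And>x. x \<in> U \<Longrightarrow> insensitive a z K I (D x)"
  shows "insensitive a z K I {y \<in> cube I K. \<forall>x\<in>U. y \<in> D x}"
  using assms unfolding insensitive_def by blast

lemma insensitive_Diff:
  assumes "insensitive a z K I D" "insensitive a z K I E"
  shows "insensitive a z K I (D - E)"
  unfolding insensitive_def
proof (intro conjI ballI impI)
  show "D - E \<subseteq> cube I K" using assms by (auto simp: insensitive_def)
  fix x y assume *: "x \<in> D - E" "y \<in> cube I K"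
    "\<forall>i\<in>I. x i = y i \<or> x i \<in> {a, z} \<and> y i \<in> {a, z}"
  then have x: "x \<in> cube I K" using assms by (auto simp: insensitive_def)
  have "y \<in> D" using assms(1) * unfolding insensitive_def by blast
  moreover have "x \<in> E" if "y \<in> E"
  proof -
    have "\<forall>i\<in>I. y i = x i \<or> y i \<in> {a, z} \<and> x i \<in> {a, z}" using *(3) by metis
    then show ?thesis using assms(2) x that unfolding insensitive_def by blast
  qed
  ultimately show "y \<in> D - E" using * by auto
qed

text \<open>Pigeonhole: by the reverse Markov inequality a proportion \<open>\<eta> / 2\<close> of
  the \<open>y\<close> have dense sections, each of these contains a member of \<open>\<U>\<close>,
  and only \<open>2 ^ card (cube J K)\<close> subsets of \<open>cube J K\<close> are
  available.\<close>

lemma dense_common_fibre: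
  assumes "J \<subseteq> I" "finite I" "finite K" "K \<noteq> {}" "E \<subseteq> cube I K" "0 < \<eta>"
    and E: "\<eta> * real (card K) ^ card I \<le> card E"
    and U: "\<And>y. y \<in> cube (I - J) K \<Longrightarrow>
      \<eta> / 2 * real (card K) ^ card J \<le> card {x \<in> cube J K. mrg J x y \<in> E} \<Longrightarrow>
      \<exists>U\<in>\<U>. U \<subseteq> {x \<in> cube J K. mrg J x y \<in> E}"
  shows "\<exists>U\<in>\<U>. U \<subseteq> cube J K \<and> \<eta> / 2 / 2 ^ card (cube J K) * real (card K) ^ card (I - J) \<le>
           card {y \<in> cube (I - J) K. \<forall>x\<in>U. mrg J x y \<in> E}"
proof (rule ccontr)
  assume neg: "\<not> ?thesis"
  let ?Y = "cube (I - J) K" and ?X = "cube J K"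
  define g where "g y = real (card {x \<in> ?X. mrg J x y \<in> E})" for y
  define G where "G = {y \<in> ?Y. \<eta> / 2 * real (card K) ^ card J \<le> g y}"
  have finJ: "finite J" using assms(1,2) finite_subset by auto
  then have fin: "finite ?X" "finite ?Y" using assms(2,3) by (auto intro!: finite_cube)
  have k: "0 < real (card K)" using assms(3,4) by (simp add: card_gt_0_iff)
  have cY: "real (card ?Y) = real (card K) ^ card (I - J)"
    using assms(2) by (intro card_cube) simp
  have "\<eta> / 2 * card ?Y \<le> card G"
    unfolding G_def
  proof (rule card_ge_half[where Y = ?Y and g = g and c = "real (card K) ^ card J" and \<eta> = \<eta>])
    show "g y \<le> real (card K) ^ card J" for y
    proof -
      have "card {x \<in> ?X. mrg J x y \<in> E} \<le> card ?X" using fin by (intro card_mono) auto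
      then show ?thesis unfolding g_def using card_cube[OF finJ, of K] by linarith
    qed
    show "real (card K) ^ card J * (\<eta> * card ?Y) \<le> sum g ?Y"
      using E unfolding g_def card_cube_fibres(2)[OF assms(1,2,3,5)] cY card_cube_split[OF assms(1,2)]
      by (simp add: algebra_simps)
  qed (use fin k assms(6) in auto)
  define V where "V = {U \<in> \<U>. U \<subseteq> ?X}"
  define f where "f U = {y \<in> ?Y. \<forall>x\<in>U. mrg J x y \<in> E}" for U
  have finV: "finite V" using fin by (simp add: V_def)
  have GV: "G \<subseteq> (\<Union>U\<in>V. f U)"
  proof
    fix y assume "y \<in> G"
    then obtain U where "U \<in> \<U>" "U \<subseteq> {x \<in> ?X. mrg J x y \<in> E}" "y \<in> ?Y"
      using U[of y] by (auto simp: G_def g_def)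
    then show "y \<in> (\<Union>U\<in>V. f U)" by (auto simp: V_def f_def)
  qed
  have cV: "card V \<le> 2 ^ card ?X"
    using card_mono[of "Pow ?X" V] fin by (auto simp: V_def card_Pow)
  have Gpos: "0 < \<eta> / 2 * real (card ?Y)" using k assms(6) unfolding cY by simp
  then have "G \<noteq> {}" using \<open>\<eta> / 2 * card ?Y \<le> card G\<close> by (intro notI) simp
  then have Vne: "V \<noteq> {}" using GV by auto
  have "\<eta> / 2 * card ?Y \<le> card G" by fact
  also have "real (card G) \<le> (\<Sum>U\<in>V. card (f U))"
  proof -
    have "card G \<le> card (\<Union>U\<in>V. f U)"
      using GV fin finV by (intro card_mono) (auto simp: f_def)
    also have "\<dots> \<le> (\<Sum>U\<in>V. card (f U))" using finV by (rule card_UN_le)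
    finally show ?thesis by (simp only: of_nat_sum[symmetric] of_nat_le_iff)
  qed
  also have "\<dots> = (\<Sum>U\<in>V. real (card (f U)))" by simp
  also have "\<dots> < (\<Sum>U\<in>V. \<eta> / 2 / 2 ^ card ?X * card ?Y)"
    using finV Vne neg cY by (intro sum_strict_mono) (auto simp: f_def V_def not_le)
  also have "\<dots> \<le> 2 ^ card ?X * (\<eta> / 2 / 2 ^ card ?X * card ?Y)"
  proof -
    have "real (card V) \<le> 2 ^ card ?X" using cV by (metis of_nat_le_iff of_nat_numeral of_nat_power)
    then have "real (card V) * (\<eta> / 2 / 2 ^ card ?X * card ?Y) \<le> 2 ^ card ?X * (\<eta> / 2 / 2 ^ card ?X * card ?Y)"
      using assms(6) by (intro mult_right_mono) auto
    then show ?thesis by simp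
  qed
  also have "\<dots> = \<eta> / 2 * card ?Y" by simp
  finally show False by simp
qed

text \<open>With \<open>Z = K\<close> the only letter outside \<open>Z\<close> is \<open>z\<close>,
  so fixing some coordinates to \<open>z\<close> leaves a dense section in a cube over
  \<open>K\<close> alone, which has a line over \<open>K\<close>. Insensitivity turns its
  \<open>a\<close>-point into the missing \<open>z\<close>-point.\<close>

lemma insensitive_has_line:
  assumes "DHJ K" "finite K" "z \<notin> K" "a \<in> K" "0 < \<eta>"
  shows "\<exists>m. \<forall>I E. finite I \<and> m \<le> card I \<and> insensitive a z (insert z K) I E \<and>
    \<eta> * real (card (insert z K)) ^ card I \<le> card E \<longrightarrow> has_line (insert z K) I E"
proof -
  let ?K = "insert z K"
  have "0 < \<eta> / 2" using assms by simp
  then obtain d where d: "\<And>I A. finite I \<Longrightarrow> d \<le> card I \<Longrightarrow> A \<subseteq> cube I K \<Longrightarrow>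
     \<eta> / 2 * real (card K) ^ card I \<le> card A \<Longrightarrow> has_line K I A"
    using assms(1) unfolding DHJ_def by meson
  obtain m where m: "\<And>I Z. finite (I::nat set) \<Longrightarrow> m \<le> card I \<Longrightarrow> Z \<subseteq> ?K \<Longrightarrow> Z \<noteq> {} \<Longrightarrow>
    card {b \<in> cube I ?K. card {i \<in> I. b i \<in> Z} < d} < \<eta> / 2 * real (card ?K) ^ card I"
    using few_hits_rare[OF _ \<open>0 < \<eta> / 2\<close>, of ?K d, where 'i = nat] assms(2) by (simp del: card_PiE) meson
  show ?thesis
  proof (intro exI allI impI, elim conjE)
    fix I E assume I: "finite I" "m \<le> card I" and E: "insensitive a z ?K I E"
      and dense: "\<eta> * real (card ?K) ^ card I \<le> card E"
    have Esub: "E \<subseteq> cube I ?K" using E by (simp add: insensitive_def)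
    have "\<exists>J c. J \<subseteq> I \<and> d \<le> card J \<and> c \<in> cube (I - J) (?K - K) \<and>
       \<eta> / 2 * real (card K) ^ card J \<le> (\<Sum>b\<in>cube J K. of_bool (mrg J b c \<in> E))"
    proof (rule exists_dense_fibre)
      show "2 * (\<eta> / 2) * real (card ?K) ^ card I \<le> (\<Sum>b\<in>cube I ?K. of_bool (b \<in> E))"
        using dense card_eq_sum_of_bool[OF finite_cube Esub] I assms by simp
      show "card {b \<in> cube I ?K. card {i \<in> I. b i \<in> K} < d} < \<eta> / 2 * real (card ?K) ^ card I"
        by (rule m) (use I assms in auto)
    qed (use I assms in auto)
    then obtain J c where J: "J \<subseteq> I" "d \<le> card J" "c \<in> cube (I - J) (?K - K)"
      "\<eta> / 2 * real (card K) ^ card J \<le> (\<Sum>b\<in>cube J K. of_bool (mrg J b c \<in> E))" by blast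
    have finJ: "finite J" using J I finite_subset by auto
    have "has_line K J {b \<in> cube J K. mrg J b c \<in> E}"
      using J(4) finJ J(2) assms
      by (intro d) (auto simp: card_Collect_eq_sum_of_bool[OF finite_cube] simp del: sum_of_bool_eq)
    then have "has_line K I E" using J(1) by (rule has_line_fibre)
    then obtain S x where S: "S \<subseteq> I" "S \<noteq> {}" "\<And>a. a \<in> K \<Longrightarrow> mrg S (\<lambda>_. a) x \<in> E"
      unfolding has_line_def by blast
    have a: "mrg S (\<lambda>_. a) x \<in> E" using S assms by blast
    have ain: "mrg S (\<lambda>_. a) x \<in> cube I ?K" using a Esub by blast
    have "mrg S (\<lambda>_. z) x \<in> cube I ?K"
    proof (rule PiE_I)
      fix i assume "i \<in> I" then show "mrg S (\<lambda>_. z) x i \<in> ?K"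
        using PiE_mem[OF ain, of i] by (auto simp: mrg_def)
    next
      fix i assume "i \<notin> I" then show "mrg S (\<lambda>_. z) x i = undefined"
        using PiE_arb[OF ain, of i] S(1) by (auto simp: mrg_def)
    qed
    moreover have "mrg S (\<lambda>_. a) x i = mrg S (\<lambda>_. z) x i \<or>
      mrg S (\<lambda>_. a) x i \<in> {a, z} \<and> mrg S (\<lambda>_. z) x i \<in> {a, z}" for i
      by (simp add: mrg_def)
    ultimately have "mrg S (\<lambda>_. z) x \<in> E" using E a unfolding insensitive_def by blast
    then show "has_line ?K I E" unfolding has_line_def using S by blast
  qed
qed

text \<open>Induction on the dimension: one line on a bounded set \<open>J\<close> of coordinates
  lies in the sections over a dense set \<open>Y\<close> of \<open>y\<close>. As an intersection of
  insensitive sets \<open>Y\<close> is insensitive again, so the induction hypothesis finds the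
  other dimensions in it.\<close>

lemma insensitive_has_subspace:
  assumes "DHJ K" "finite K" "z \<notin> K" "a \<in> K" "0 < \<eta>"
  shows "\<exists>m. \<forall>I E. finite I \<and> m \<le> card I \<and> insensitive a z (insert z K) I E \<and>
    \<eta> * real (card (insert z K)) ^ card I \<le> card E \<longrightarrow>
    (\<exists>w. subspace_word (insert z K) {..<M} I w \<and> subst I w ` cube {..<M} (insert z K) \<subseteq> E)"
  using assms(5)
proof (induction M arbitrary: \<eta>)
  case 0
  let ?K = "insert z K"
  show ?case
  proof (intro exI[of _ 0] allI impI, elim conjE)
    fix I E assume I: "finite I" and E: "insensitive a z ?K I E"
      and dense: "\<eta> * real (card ?K) ^ card I \<le> card E"
    have "0 < \<eta> * real (card ?K) ^ card I" using 0 assms by (simp add: card_gt_0_iff)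
    then have "E \<noteq> {}" using dense by auto
    then obtain x where x: "x \<in> E" by blast
    then have "x \<in> cube I ?K" using E by (auto simp: insensitive_def)
    then show "\<exists>w. subspace_word ?K {..<0} I w \<and> subst I w ` cube {..<0} ?K \<subseteq> E"
      using x by (intro exI[of _ "\<lambda>i. Inl (x i)"]) (auto simp: subspace_word_const subst_const)
  qed
next
  case (Suc M)
  let ?K = "insert z K"
  have K: "finite ?K" "?K \<noteq> {}" using assms by auto
  have "0 < \<eta> / 2" using Suc.prems by simp
  from insensitive_has_line[OF assms(1-4) this] obtain m1 where
    m1: "\<And>I E. finite I \<Longrightarrow> m1 \<le> card I \<Longrightarrow> insensitive a z ?K I E \<Longrightarrow>
      \<eta> / 2 * real (card ?K) ^ card I \<le> card E \<Longrightarrow> has_line ?K I E" by blast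
  \<comment> \<open>The density of \<open>Y\<close> supplied by \<open>dense_common_fibre\<close>;
    the exponent is the size of the cube over the \<open>m1\<close> coordinates of
    \<open>J\<close>.\<close>
  define \<eta>' where "\<eta>' = \<eta> / 2 / 2 ^ (card ?K ^ m1)"
  have "0 < \<eta>'" using Suc.prems by (simp add: \<eta>'_def)
  from Suc.IH[OF this] obtain m2 where
    m2: "\<And>I E. finite I \<Longrightarrow> m2 \<le> card I \<Longrightarrow> insensitive a z ?K I E \<Longrightarrow>
      \<eta>' * real (card ?K) ^ card I \<le> card E \<Longrightarrow>
      \<exists>w. subspace_word ?K {..<M} I w \<and> subst I w ` cube {..<M} ?K \<subseteq> E" by meson
  show ?case
  proof (intro exI[of _ "m1 + m2"] allI impI, elim conjE)
    fix I E assume I: "finite I" "m1 + m2 \<le> card I" and E: "insensitive a z ?K I E"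
      and dense: "\<eta> * real (card ?K) ^ card I \<le> card E"
    have Esub: "E \<subseteq> cube I ?K" using E by (simp add: insensitive_def)
    obtain J where J: "J \<subseteq> I" "card J = m1" "finite J"
      using obtain_subset_with_card_n[of m1 I] I by auto
    have IJ: "finite (I - J)" "m2 \<le> card (I - J)" using I J by (auto simp: card_Diff_subset)
    define \<U> where "\<U> = {{mrg S (\<lambda>_. a) x | a. a \<in> ?K} | S x. S \<subseteq> J \<and> S \<noteq> {}}"
    have fib: "insensitive a z ?K J {x \<in> cube J ?K. mrg J x y \<in> E}" if "y \<in> cube (I - J) ?K" for y
    proof -
      have "insensitive a z ?K (I - (I - J)) {u \<in> cube (I - (I - J)) ?K. mrg (I - J) y u \<in> E}"
        using that by (intro insensitive_fibre[OF E]) auto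
      moreover have "I - (I - J) = J" using J by auto
      ultimately have "insensitive a z ?K J {u \<in> cube J ?K. mrg (I - J) y u \<in> E}" by simp
      moreover have "{u \<in> cube J ?K. mrg (I - J) y u \<in> E} = {u \<in> cube J ?K. mrg J u y \<in> E}"
        using mrg_commute[OF J(1) _ that] by auto
      ultimately show ?thesis by simp
    qed
    have "\<exists>U\<in>\<U>. U \<subseteq> cube J ?K \<and> \<eta> / 2 / 2 ^ card (cube J ?K) * real (card ?K) ^ card (I - J) \<le>
           card {y \<in> cube (I - J) ?K. \<forall>x\<in>U. mrg J x y \<in> E}"
    proof (rule dense_common_fibre[OF J(1) I(1) K Esub Suc.prems dense])
      fix y assume y: "y \<in> cube (I - J) ?K"
        and "\<eta> / 2 * real (card ?K) ^ card J \<le> card {x \<in> cube J ?K. mrg J x y \<in> E}"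
      then have "has_line ?K J {x \<in> cube J ?K. mrg J x y \<in> E}"
        using fib[OF y] J by (intro m1) auto
      then obtain S x where "S \<subseteq> J" "S \<noteq> {}"
        "\<forall>a\<in>?K. mrg S (\<lambda>_. a) x \<in> {x \<in> cube J ?K. mrg J x y \<in> E}"
        unfolding has_line_def by blast
      then show "\<exists>U\<in>\<U>. U \<subseteq> {x \<in> cube J ?K. mrg J x y \<in> E}"
        unfolding \<U>_def by (intro bexI[of _ "{mrg S (\<lambda>_. a) x | a. a \<in> ?K}"]) blast+
    qed
    then obtain S x where S: "S \<subseteq> J" "S \<noteq> {}" and
      Sx: "{mrg S (\<lambda>_. a) x | a. a \<in> ?K} \<subseteq> cube J ?K" and
      dense': "\<eta> / 2 / 2 ^ card (cube J ?K) * real (card ?K) ^ card (I - J) \<le>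
           card {y \<in> cube (I - J) ?K. \<forall>u\<in>{mrg S (\<lambda>_. a) x | a. a \<in> ?K}. mrg J u y \<in> E}"
      unfolding \<U>_def by blast
    define U where "U = {mrg S (\<lambda>_. a) x | a. a \<in> ?K}"
    define Y where "Y = {y \<in> cube (I - J) ?K. \<forall>u\<in>U. mrg J u y \<in> E}"
    have "Y = {y \<in> cube (I - J) ?K. \<forall>u\<in>U. y \<in> {v \<in> cube (I - J) ?K. mrg J u v \<in> E}}"
      by (auto simp: Y_def)
    moreover have "insensitive a z ?K (I - J) \<dots>"
      using Sx by (intro insensitive_INT insensitive_fibre[OF E J(1)]) (auto simp: U_def)
    ultimately have insY: "insensitive a z ?K (I - J) Y" by simp
    have "card (cube J ?K) = card ?K ^ m1" using J by (simp add: card_PiE)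
    then have "\<eta>' * real (card ?K) ^ card (I - J) \<le> card Y"
      using dense' by (simp add: \<eta>'_def Y_def U_def)
    from m2[OF IJ insY this] obtain w where w: "subspace_word ?K {..<M} (I - J) w"
      "subst (I - J) w ` cube {..<M} ?K \<subseteq> Y" by blast
    \<comment> \<open>The variables of \<open>w\<close> are those below \<open>M\<close>, so the
      line on \<open>J\<close> can take \<open>M\<close> as its variable.\<close>
    define v where "v i = (if i \<in> S then Inr M else Inl (x i))" for i
    have zin: "mrg S (\<lambda>_. z) x \<in> cube J ?K" using Sx by blast
    have v: "subspace_word ?K {M} J v"
      using S PiE_mem[OF zin] by (fastforce simp: subspace_word_def v_def mrg_def)
    have vsub: "subst J v u = mrg S (\<lambda>_. u M) x" for u
      using S PiE_arb[OF zin] by (fastforce simp: subst_def v_def mrg_def fun_eq_iff)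
    have "subspace_word ?K {..<Suc M} I (mrg J v w)"
      using subspace_word_mrg[OF J(1) v w(1)] by (simp add: lessThan_Suc)
    moreover have "subst I (mrg J v w) u \<in> E" if "u \<in> cube {..<Suc M} ?K" for u
    proof -
      have eq: "subst (I - J) w u = subst (I - J) w (restrict u {..<M})"
      proof
        fix i show "subst (I - J) w u i = subst (I - J) w (restrict u {..<M}) i"
        proof (cases "i \<in> I - J")
          case True
          then have "w i \<in> Inl ` ?K \<union> Inr ` {..<M}" using w(1) by (auto simp: subspace_word_def)
          then show ?thesis using True by (auto simp: subst_def)
        qed (auto simp: subst_def)
      qed
      have "restrict u {..<M} \<in> cube {..<M} ?K" using that by (auto simp: PiE_iff)
      then have "subst (I - J) w u \<in> Y" unfolding eq using w(2) by blast
      moreover have "mrg S (\<lambda>_. u M) x \<in> U" unfolding U_def using PiE_mem[OF that, of M] by blast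
      ultimately have "mrg J (mrg S (\<lambda>_. u M) x) (subst (I - J) w u) \<in> E" by (simp add: Y_def)
      then show ?thesis by (simp add: subst_mrg[OF J(1)] vsub)
    qed
    ultimately show "\<exists>w. subspace_word ?K {..<Suc M} I w \<and> subst I w ` cube {..<Suc M} ?K \<subseteq> E"
      by (intro exI[of _ "mrg J v w"]) blast
  qed
qed

section \<open>Sums over insensitive sets\<close>

text \<open>For \<open>\<lambda>x. of_bool (x \<in> B) - \<kappa>\<close> this bounds the density of
  \<open>B\<close> on \<open>M\<close>-dimensional subspaces by \<kappa>. Real functions take the
  place of sets because the induction over the letters multiplies \<open>F\<close> by an indicator
  and subtracts a constant.\<close>

definition nonpos_on :: "nat \<Rightarrow> 'a set \<Rightarrow> nat set \<Rightarrow> ((nat \<Rightarrow> 'a) \<Rightarrow> real) \<Rightarrow> bool" where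
  "nonpos_on M K I F \<longleftrightarrow>
     (\<forall>w. subspace_word K {..<M} I w \<longrightarrow> (\<Sum>u\<in>cube {..<M} K. F (subst I w u)) \<le> 0)"

lemma nonpos_on_fibre:
  assumes "nonpos_on M K I F" "J \<subseteq> I" "x \<in> cube J K"
  shows "nonpos_on M K (I - J) (\<lambda>y. F (mrg J x y))"
  unfolding nonpos_on_def
proof (intro allI impI)
  fix w assume "subspace_word K {..<M} (I - J) w"
  then have "subspace_word K ({} \<union> {..<M}) I (mrg J (\<lambda>i. Inl (x i)) w)"
    using assms by (intro subspace_word_mrg subspace_word_const) auto
  then have "(\<Sum>u\<in>cube {..<M} K. F (subst I (mrg J (\<lambda>i. Inl (x i)) w) u)) \<le> 0"
    using assms(1) by (simp add: nonpos_on_def)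
  then show "(\<Sum>u\<in>cube {..<M} K. F (mrg J x (subst (I - J) w u))) \<le> 0"
    by (simp add: subst_mrg[OF assms(2)] subst_const[OF assms(3)])
qed

lemma nonpos_on_subst:
  assumes "nonpos_on M K I F" "subspace_word K J I w"
  shows "nonpos_on M K J (\<lambda>x. F (subst I w x))"
  unfolding nonpos_on_def
proof (intro allI impI)
  fix v assume "subspace_word K {..<M} J v"
  from subspace_word_subst[OF assms(2) this] assms(1)
  show "(\<Sum>u\<in>cube {..<M} K. F (subst I w (subst J v u))) \<le> 0"
    by (simp add: nonpos_on_def subst_subst[OF assms(2)])
qed

text \<open>
  Greedy exhaustion: inside \<open>D\<close> one removes a set \<open>U \<times> Y\<close> with \<open>U\<close> a subspace and \<open>Y\<close> insensitive of
  positive density. The fibres of the rest over the coordinates of \<open>U\<close> are again insensitive, so one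
  can continue in each of them; every round shrinks the main term by the factor \<open>1 - c\<close>.
\<close>

lemma sum_insensitive_step:
  assumes "DHJ K" "finite K" "z \<notin> K" "a \<in> K" "0 < \<eta>"
  shows "\<exists>c::real. 0 < c \<and> c \<le> 1 \<and> (\<forall>n. \<exists>d. \<forall>I D F. finite I \<and> d \<le> card I \<and> insensitive a z (insert z K) I D \<and>
    (\<forall>x\<in>cube I (insert z K). F x \<le> 1) \<and> nonpos_on M (insert z K) I F \<longrightarrow>
    (\<Sum>x\<in>D. F x) \<le> (1 - c) ^ n * card D + \<eta> * real (card (insert z K)) ^ card I)"
proof -
  let ?K = "insert z K"
  define k where "k = real (card ?K)"
  have K: "finite ?K" "?K \<noteq> {}" using assms by auto
  have "1 \<le> card ?K" using K by (simp add: Suc_le_eq card_gt_0_iff)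
  then have k: "1 \<le> k" unfolding k_def by linarith
  have "0 < \<eta> / 2" using assms by simp
  from insensitive_has_subspace[OF assms(1-4) this, of M] obtain m where
    m: "\<And>I E. finite I \<Longrightarrow> m \<le> card I \<Longrightarrow> insensitive a z ?K I E \<Longrightarrow> \<eta> / 2 * k ^ card I \<le> card E \<Longrightarrow>
       \<exists>w. subspace_word ?K {..<M} I w \<and> subst I w ` cube {..<M} ?K \<subseteq> E" 
    unfolding k_def by meson
  \<comment> \<open>\<open>c0\<close> bounds the density of the set \<open>Y\<close> below, and as
    \<open>U\<close> is nonempty, \<open>U \<times> Y\<close> is at least a proportion
    \<open>c0 / k ^ m\<close> of the whole cube. The minimum in \<open>c\<close> keeps
    \<open>1 - c\<close> nonnegative.\<close>
  define c0 where "c0 = \<eta> / 2 / 2 ^ (card ?K ^ m)"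
  define c where "c = min 1 (c0 / k ^ m)"
  have c0: "0 < c0" using assms by (simp add: c0_def)
  have c: "0 < c" "c \<le> 1" "c \<le> c0 / k ^ m" using c0 k by (auto simp: c_def)
  have "\<exists>d. \<forall>I D F. finite I \<and> d \<le> card I \<and> insensitive a z ?K I D \<and>
    (\<forall>x\<in>cube I ?K. F x \<le> 1) \<and> nonpos_on M ?K I F \<longrightarrow>
    (\<Sum>x\<in>D. F x) \<le> (1 - c) ^ n * card D + \<eta> * k ^ card I" for n
  proof (induction n)
    case 0
    have "(\<Sum>x\<in>D. F x) \<le> card D + \<eta> * k ^ card I"
      if "finite I" "insensitive a z ?K I D" "\<forall>x\<in>cube I ?K. F x \<le> 1" for I D and F :: "(nat \<Rightarrow> 'a) \<Rightarrow> real"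
    proof -
      have "(\<Sum>x\<in>D. F x) \<le> (\<Sum>x\<in>D. 1)" using that by (intro sum_mono) (auto simp: insensitive_def)
      moreover have "0 \<le> \<eta> * k ^ card I" using assms k by simp
      ultimately show ?thesis by simp
    qed
    then show ?case by auto
  next
    case (Suc n)
    then obtain d where d: "\<And>I D F. finite I \<Longrightarrow> d \<le> card I \<Longrightarrow> insensitive a z ?K I D \<Longrightarrow>
      (\<forall>x\<in>cube I ?K. F x \<le> 1) \<Longrightarrow> nonpos_on M ?K I F \<Longrightarrow>
      (\<Sum>x\<in>D. F x) \<le> (1 - c) ^ n * card D + \<eta> * k ^ card I"
      by meson
    show ?case
    proof (intro exI[of _ "m + d"] allI impI, elim conjE)
      fix I D and F :: "(nat \<Rightarrow> 'a) \<Rightarrow> real"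
      assume I: "finite I" "m + d \<le> card I" and D: "insensitive a z ?K I D"
        and F: "\<forall>x\<in>cube I ?K. F x \<le> 1" "nonpos_on M ?K I F"
      have Dsub: "D \<subseteq> cube I ?K" using D by (simp add: insensitive_def)
      have finI: "finite (cube I ?K)" using I K by (intro finite_cube)
      have finD: "finite D" using Dsub finI finite_subset by blast
      show "(\<Sum>x\<in>D. F x) \<le> (1 - c) ^ Suc n * card D + \<eta> * k ^ card I"
      proof (cases "\<eta> * k ^ card I \<le> card D")
        case False
        \<comment> \<open>A set this sparse is absorbed by the error term through
          \<open>F \<le> 1\<close> alone.\<close>
        have "(\<Sum>x\<in>D. F x) \<le> (\<Sum>x\<in>D. 1)" using F Dsub by (intro sum_mono) auto
        also have "\<dots> \<le> \<eta> * k ^ card I" using False by simp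
        also have "\<dots> \<le> (1 - c) ^ Suc n * card D + \<eta> * k ^ card I" using c by simp
        finally show ?thesis .
      next
        case True
        obtain J where J: "J \<subseteq> I" "card J = m" "finite J"
          using obtain_subset_with_card_n[of m I] I by auto
        let ?X = "cube J ?K" and ?Y = "cube (I - J) ?K"
        have IJ: "finite (I - J)" "d \<le> card (I - J)" using I J by (auto simp: card_Diff_subset)
        have finX: "finite ?X" "finite ?Y" using J IJ K by (auto intro!: finite_cube)
        have split: "k ^ card I = k ^ m * k ^ card (I - J)"
          using card_cube_split[OF J(1) I(1), of ?K] J(2) by (simp add: k_def)
        have fib: "insensitive a z ?K J {x \<in> ?X. mrg J x y \<in> D}" if "y \<in> ?Y" for y
        proof -
          have "insensitive a z ?K (I - (I - J)) {u \<in> cube (I - (I - J)) ?K. mrg (I - J) y u \<in> D}"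
            using that by (intro insensitive_fibre[OF D]) auto
          moreover have "I - (I - J) = J" using J by auto
          moreover have "{u \<in> ?X. mrg (I - J) y u \<in> D} = {u \<in> ?X. mrg J u y \<in> D}"
            using mrg_commute[OF J(1) _ that] by auto
          ultimately show ?thesis by simp
        qed
        define \<U> where "\<U> = {subst J w ` cube {..<M} ?K | w. subspace_word ?K {..<M} J w}"
        have "\<exists>U\<in>\<U>. U \<subseteq> ?X \<and> \<eta> / 2 / 2 ^ card ?X * real (card ?K) ^ card (I - J) \<le>
           card {y \<in> ?Y. \<forall>x\<in>U. mrg J x y \<in> D}"
        proof (rule dense_common_fibre[OF J(1) I(1) K Dsub assms(5)])
          show "\<eta> * real (card ?K) ^ card I \<le> card D" using True by (simp add: k_def)
          fix y assume y: "y \<in> ?Y"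
            and "\<eta> / 2 * real (card ?K) ^ card J \<le> card {x \<in> ?X. mrg J x y \<in> D}"
          then have "\<exists>w. subspace_word ?K {..<M} J w \<and> subst J w ` cube {..<M} ?K \<subseteq> {x \<in> ?X. mrg J x y \<in> D}"
            using J by (intro m fib[OF y]) (auto simp: k_def)
          then show "\<exists>U\<in>\<U>. U \<subseteq> {x \<in> ?X. mrg J x y \<in> D}"
            unfolding \<U>_def by blast
        qed
        then obtain w where w: "subspace_word ?K {..<M} J w" and
          dense: "\<eta> / 2 / 2 ^ card ?X * real (card ?K) ^ card (I - J) \<le>
           card {y \<in> ?Y. \<forall>x\<in>subst J w ` cube {..<M} ?K. mrg J x y \<in> D}"
          unfolding \<U>_def by blast
        define U where "U = subst J w ` cube {..<M} ?K"
        define Y where "Y = {y \<in> ?Y. \<forall>x\<in>U. mrg J x y \<in> D}"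
        have USub: "U \<subseteq> ?X" using subst_in_cube[OF w] by (auto simp: U_def)
        have "card ?X = card ?K ^ m" using J by (simp add: card_PiE)
        then have cY: "c0 * k ^ card (I - J) \<le> card Y"
          using dense by (simp add: c0_def k_def Y_def U_def)
        have "Y = {y \<in> ?Y. \<forall>x\<in>U. y \<in> {v \<in> ?Y. mrg J x v \<in> D}}" by (auto simp: Y_def)
        moreover have "insensitive a z ?K (I - J) \<dots>"
          using USub by (intro insensitive_INT insensitive_fibre[OF D J(1)]) auto
        ultimately have insY: "insensitive a z ?K (I - J) Y" by simp
        have Yfin: "finite Y" "Y \<subseteq> ?Y" using finX by (auto simp: Y_def)
        \<comment> \<open>The section over \<open>x\<close> of what is left of \<open>D\<close>.
          Each such section is insensitive, whereas the rest of \<open>D\<close> as a whole need not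
          be, since \<open>U\<close> is merely a subspace.\<close>
        define D' where "D' x = {y \<in> ?Y. mrg J x y \<in> D} - (if x \<in> U then Y else {})" for x
        have insD': "insensitive a z ?K (I - J) (D' x)" if "x \<in> ?X" for x
          using insensitive_Diff[OF insensitive_fibre[OF D J(1) that] insY] insensitive_fibre[OF D J(1) that]
          by (simp add: D'_def)
        \<comment> \<open>Used twice: with \<open>F\<close> for the sum, and with the constant 1 for
          the cardinality.\<close>
        have split_sum: "(\<Sum>x\<in>D. G x) = (\<Sum>y\<in>Y. \<Sum>x\<in>U. G (mrg J x y)) + (\<Sum>x\<in>?X. \<Sum>y\<in>D' x. G (mrg J x y))"
          for G :: "(nat \<Rightarrow> 'a) \<Rightarrow> real"
        proof -
          have "(\<Sum>x\<in>D. G x) = (\<Sum>x\<in>cube I ?K. of_bool (x \<in> D) * G x)"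
            using Dsub finI by (simp add: of_bool_def if_distrib[of "\<lambda>u. u * _"] sum.If_cases Int_absorb1 cong: if_cong)
          also have "\<dots> = (\<Sum>x\<in>?X. \<Sum>y\<in>?Y. of_bool (mrg J x y \<in> D) * G (mrg J x y))"
            by (rule sum_cube_split[OF J(1)])
          also have "\<dots> = (\<Sum>x\<in>?X. (\<Sum>y\<in>(if x \<in> U then Y else {}). G (mrg J x y)) + (\<Sum>y\<in>D' x. G (mrg J x y)))"
          proof (rule sum.cong[OF refl])
            fix x assume x: "x \<in> ?X"
            let ?D = "{y \<in> ?Y. mrg J x y \<in> D}"
            have "(\<Sum>y\<in>?Y. of_bool (mrg J x y \<in> D) * G (mrg J x y)) = (\<Sum>y\<in>?D. G (mrg J x y))"
              using finX by (simp add: of_bool_def if_distrib[of "\<lambda>u. u * _"] sum.If_cases Int_def cong: if_cong)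
            also have "\<dots> = (\<Sum>y\<in>?D - (if x \<in> U then Y else {}). G (mrg J x y)) + (\<Sum>y\<in>(if x \<in> U then Y else {}). G (mrg J x y))"
              using finX by (intro sum.subset_diff) (auto simp: Y_def)
            finally show "(\<Sum>y\<in>?Y. of_bool (mrg J x y \<in> D) * G (mrg J x y)) =
              (\<Sum>y\<in>(if x \<in> U then Y else {}). G (mrg J x y)) + (\<Sum>y\<in>D' x. G (mrg J x y))"
              by (simp add: D'_def)
          qed
          also have "\<dots> = (\<Sum>x\<in>?X. if x \<in> U then (\<Sum>y\<in>Y. G (mrg J x y)) else 0) + (\<Sum>x\<in>?X. \<Sum>y\<in>D' x. G (mrg J x y))"
            by (simp add: sum.distrib if_distrib[of "\<lambda>A. sum _ A"] cong: if_cong)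
          also have "(\<Sum>x\<in>?X. if x \<in> U then (\<Sum>y\<in>Y. G (mrg J x y)) else 0) = (\<Sum>x\<in>U. \<Sum>y\<in>Y. G (mrg J x y))"
            using finX USub by (simp add: sum.If_cases Int_absorb1)
          also have "\<dots> = (\<Sum>y\<in>Y. \<Sum>x\<in>U. G (mrg J x y))" by (rule sum.swap)
          finally show ?thesis .
        qed
        \<comment> \<open>For fixed \<open>y\<close> in \<open>Y\<close> the set
          \<open>U \<times> {y}\<close> is an \<open>M\<close>-dimensional subspace of
          \<open>cube I ?K\<close>, so \<open>nonpos_on\<close> applies.\<close>
        have "(\<Sum>x\<in>U. F (mrg J x y)) \<le> 0" if "y \<in> Y" for y
        proof -
          have y: "y \<in> ?Y" using that Yfin by auto
          have "(\<Sum>x\<in>U. F (mrg J x y)) = (\<Sum>u\<in>cube {..<M} ?K. F (mrg J (subst J w u) y))"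
            unfolding U_def by (subst sum.reindex[OF inj_on_subst[OF w]]) simp
          also have "\<dots> = (\<Sum>u\<in>cube {..<M} ?K. F (subst I (mrg J w (\<lambda>i. Inl (y i))) u))"
            by (simp add: subst_mrg[OF J(1)] subst_const[OF y])
          also have "\<dots> \<le> 0"
            using F(2) subspace_word_mrg[OF J(1) w subspace_word_const[OF y]] by (simp add: nonpos_on_def)
          finally show ?thesis .
        qed
        then have "(\<Sum>y\<in>Y. \<Sum>x\<in>U. F (mrg J x y)) \<le> 0" by (rule sum_nonpos)
        moreover have "(\<Sum>x\<in>?X. \<Sum>y\<in>D' x. F (mrg J x y)) \<le>
            (\<Sum>x\<in>?X. (1 - c) ^ n * card (D' x) + \<eta> * k ^ card (I - J))"
        proof (rule sum_mono)
          fix x assume x: "x \<in> ?X"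
          show "(\<Sum>y\<in>D' x. F (mrg J x y)) \<le> (1 - c) ^ n * card (D' x) + \<eta> * k ^ card (I - J)"
            using F(1) mrg_in_cube[OF J(1) x]
            by (intro d IJ insD' x nonpos_on_fibre F(2) J(1) ballI) blast
        qed
        ultimately have "(\<Sum>x\<in>D. F x) \<le> (\<Sum>x\<in>?X. (1 - c) ^ n * card (D' x) + \<eta> * k ^ card (I - J))"
          unfolding split_sum[of F] by linarith
        \<comment> \<open>The errors of the \<open>k ^ m\<close> fibres add up to \<eta> times the
          whole cube, so the error term does not grow with the rounds.\<close>
        also have "\<dots> = (1 - c) ^ n * (\<Sum>x\<in>?X. real (card (D' x))) + \<eta> * k ^ card I"
        proof -
          have "real (card ?X) = k ^ m" using card_cube[OF J(3), of ?K] J(2) by (simp add: k_def)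
          then show ?thesis by (simp add: sum.distrib sum_distrib_left split)
        qed
        also have "(\<Sum>x\<in>?X. real (card (D' x))) = real (card D) - real (card Y) * real (card U)"
          using split_sum[of "\<lambda>_. 1"] by simp
        also have "(1 - c) ^ n * (real (card D) - real (card Y) * real (card U)) \<le> (1 - c) ^ n * ((1 - c) * card D)"
        proof -
          have "cube {..<M} ?K \<noteq> {}" by (auto simp: PiE_eq_empty_iff)
          then have "1 \<le> card U" using finite_subset[OF USub finX(1)]
            by (simp add: Suc_le_eq card_gt_0_iff U_def)
          have "real (card D) \<le> k ^ card I"
            using card_mono[OF finI Dsub] card_cube[OF I(1), of ?K] unfolding k_def by linarith
          then have "c * card D \<le> c0 / k ^ m * k ^ card I"
            using c k c0 by (intro mult_mono) auto
          also have "\<dots> = c0 * k ^ card (I - J)" using k by (simp add: split)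
          also have "\<dots> \<le> card Y" by (rule cY)
          also have "\<dots> \<le> card Y * real (card U)" using \<open>1 \<le> card U\<close>
            by (metis mult.right_neutral mult_left_mono of_nat_0_le_iff of_nat_1 of_nat_le_iff)
          finally have "real (card D) - real (card Y) * real (card U) \<le> (1 - c) * card D"
            by (simp add: algebra_simps)
          then show ?thesis using c by (intro mult_left_mono) auto
        qed
        finally show ?thesis by (simp add: mult.assoc mult.left_commute)
      qed
    qed
  qed
  then show ?thesis using c unfolding k_def by blast
qed

text \<open>Since \<open>c\<close> does not depend on the number \<open>n\<close> of rounds,
  \<open>n\<close> can be chosen with \<open>(1 - c) ^ n < \<eta> / 2\<close>.\<close>

lemma sum_insensitive_le:
  assumes "DHJ K" "finite K" "z \<notin> K" "a \<in> K" "0 < \<eta>"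
  shows "\<exists>d. \<forall>I D F. finite I \<and> d \<le> card I \<and> insensitive a z (insert z K) I D \<and>
    (\<forall>x\<in>cube I (insert z K). F x \<le> 1) \<and> nonpos_on M (insert z K) I F \<longrightarrow>
    (\<Sum>x\<in>D. F x) \<le> \<eta> * real (card (insert z K)) ^ card I"
proof -
  let ?K = "insert z K"
  have "0 < \<eta> / 2" using assms by simp
  from sum_insensitive_step[OF assms(1-4) this, of M] obtain c :: real where c: "0 < c" "c \<le> 1" and
    step: "\<And>n. \<exists>d. \<forall>I D F. finite I \<and> d \<le> card I \<and> insensitive a z ?K I D \<and>
    (\<forall>x\<in>cube I ?K. F x \<le> 1) \<and> nonpos_on M ?K I F \<longrightarrow>
    (\<Sum>x\<in>D. F x) \<le> (1 - c) ^ n * card D + \<eta> / 2 * real (card ?K) ^ card I"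
    by meson
  obtain n where n: "(1 - c) ^ n < \<eta> / 2"
    using real_arch_pow_inv[of "\<eta> / 2" "1 - c"] c assms by auto
  from step[of n] obtain d where d: "\<And>I D F. finite I \<Longrightarrow> d \<le> card I \<Longrightarrow> insensitive a z ?K I D \<Longrightarrow>
    \<forall>x\<in>cube I ?K. F x \<le> 1 \<Longrightarrow> nonpos_on M ?K I F \<Longrightarrow>
    (\<Sum>x\<in>D. F x) \<le> (1 - c) ^ n * card D + \<eta> / 2 * real (card ?K) ^ card I"
    by meson
  show ?thesis
  proof (intro exI[of _ d] allI impI, elim conjE)
    fix I D and F :: "(nat \<Rightarrow> 'a) \<Rightarrow> real"
    assume *: "finite I" "d \<le> card I" "insensitive a z ?K I D" "\<forall>x\<in>cube I ?K. F x \<le> 1"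
      "nonpos_on M ?K I F"
    have "real (card D) \<le> real (card ?K) ^ card I"
      using card_mono[of "cube I ?K" D] finite_cube[of I ?K] * assms card_cube[OF *(1), of ?K]
      unfolding insensitive_def by (metis finite_insert of_nat_le_iff)
    then have "(1 - c) ^ n * card D \<le> \<eta> / 2 * real (card ?K) ^ card I"
      using n c assms by (intro mult_mono) auto
    then show "(\<Sum>x\<in>D. F x) \<le> \<eta> * real (card ?K) ^ card I"
      using d[OF *] by linarith
  qed
qed

text \<open>Induction on \<open>L\<close>. The complement of \<open>D a\<close> is insensitive.
  Inside \<open>D a\<close> remain the words that miss some \<open>D b\<close> with \<open>b\<close>
  in \<open>L\<close>; their set \<open>E\<close> need not be insensitive for any one letter. But on
  subspaces of a dimension \<open>M'\<close> large enough for the induction hypothesis, the sum of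
  \<open>F\<close> over \<open>E\<close> is small, so
  \<open>F x * of_bool (x \<in> E) - \<eta> / 3\<close> has nonpositive sum there and can be summed
  over the insensitive set \<open>D a\<close>.\<close>

lemma sum_not_all_insensitive_le:
  assumes "DHJ K" "finite K" "z \<notin> K" "finite L" "L \<subseteq> K" "0 < \<eta>"
  shows "\<exists>d. \<forall>I D F. finite I \<and> d \<le> card I \<and> (\<forall>a\<in>L. insensitive a z (insert z K) I (D a)) \<and>
    (\<forall>x\<in>cube I (insert z K). F x \<le> 1) \<and> nonpos_on M (insert z K) I F \<longrightarrow>
    (\<Sum>x\<in>{x \<in> cube I (insert z K). \<exists>a\<in>L. x \<notin> D a}. F x) \<le> \<eta> * real (card (insert z K)) ^ card I"
  using assms(4,5,6)
proof (induction L arbitrary: \<eta>)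
  case empty
  then show ?case by auto
next
  case (insert a L)
  let ?K = "insert z K"
  \<comment> \<open>One third is for the complement of \<open>D a\<close>, one for the sum over
    \<open>D a\<close>, and one for adding back the subtracted constant.\<close>
  have \<eta>: "0 < \<eta> / 3" and a: "a \<in> K" using insert.prems by auto
  have "L \<subseteq> K" using insert.prems by simp
  from insert.IH[OF this \<eta>] obtain M' where M': "\<forall>I D F. finite I \<and> M' \<le> card I \<and>
    (\<forall>a\<in>L. insensitive a z ?K I (D a)) \<and> (\<forall>x\<in>cube I ?K. F x \<le> 1) \<and> nonpos_on M ?K I F \<longrightarrow>
    (\<Sum>x\<in>{x \<in> cube I ?K. \<exists>a\<in>L. x \<notin> D a}. F x) \<le> \<eta> / 3 * real (card ?K) ^ card I" ..
  from sum_insensitive_le[OF assms(1-3) a \<eta>, of M'] obtain d1 where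
    d1: "\<And>I D F. finite I \<Longrightarrow> d1 \<le> card I \<Longrightarrow> insensitive a z ?K I D \<Longrightarrow>
    \<forall>x\<in>cube I ?K. F x \<le> 1 \<Longrightarrow> nonpos_on M' ?K I F \<Longrightarrow>
    (\<Sum>x\<in>D. F x) \<le> \<eta> / 3 * real (card ?K) ^ card I" by meson
  from sum_insensitive_le[OF assms(1-3) a \<eta>, of M] obtain d2 where
    d2: "\<And>I D F. finite I \<Longrightarrow> d2 \<le> card I \<Longrightarrow> insensitive a z ?K I D \<Longrightarrow>
    \<forall>x\<in>cube I ?K. F x \<le> 1 \<Longrightarrow> nonpos_on M ?K I F \<Longrightarrow>
    (\<Sum>x\<in>D. F x) \<le> \<eta> / 3 * real (card ?K) ^ card I" by meson
  show ?case
  proof (intro exI[of _ "max d1 d2"] allI impI, elim conjE)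
    fix I D and F :: "(nat \<Rightarrow> 'a) \<Rightarrow> real"
    assume I: "finite I" "max d1 d2 \<le> card I" and D: "\<forall>b\<in>insert a L. insensitive b z ?K I (D b)"
      and F: "\<forall>x\<in>cube I ?K. F x \<le> 1" "nonpos_on M ?K I F"
    define E where "E = {x \<in> cube I ?K. \<exists>b\<in>L. x \<notin> D b}"
    define q where "q = real (card ?K)"
    have finI: "finite (cube I ?K)" using I assms by (intro finite_cube) auto
    have Da: "insensitive a z ?K I (D a)" and Dsub: "D a \<subseteq> cube I ?K" using D by (auto simp: insensitive_def)
    have "insensitive a z ?K I (cube I ?K)" by (auto simp: insensitive_def)
    from insensitive_Diff[OF this Da] have Dc: "insensitive a z ?K I (cube I ?K - D a)" .
    have 1: "(\<Sum>x\<in>cube I ?K - D a. F x) \<le> \<eta> / 3 * q ^ card I"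
      using d2[OF I(1) _ Dc F] I by (simp add: q_def)
    have "(\<Sum>x\<in>D a. F x * of_bool (x \<in> E) - \<eta> / 3) \<le> \<eta> / 3 * q ^ card I"
      unfolding q_def
    proof (rule d1[OF I(1) _ Da])
      show "d1 \<le> card I" using I by simp
      show "\<forall>x\<in>cube I ?K. F x * of_bool (x \<in> E) - \<eta> / 3 \<le> 1"
      proof
        fix x assume "x \<in> cube I ?K"
        then have "F x * of_bool (x \<in> E) \<le> 1" using F by (auto simp: of_bool_def)
        then show "F x * of_bool (x \<in> E) - \<eta> / 3 \<le> 1" using \<eta> by linarith
      qed
      show "nonpos_on M' ?K I (\<lambda>x. F x * of_bool (x \<in> E) - \<eta> / 3)"
        unfolding nonpos_on_def
      proof (intro allI impI)
        fix w assume w: "subspace_word ?K {..<M'} I w"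
        let ?C = "cube {..<M'} ?K"
        have finC: "finite ?C" using assms by (intro finite_cube) auto
        have "(\<Sum>u\<in>{u \<in> ?C. \<exists>b\<in>L. u \<notin> {u \<in> ?C. subst I w u \<in> D b}}. F (subst I w u)) \<le>
          \<eta> / 3 * real (card ?K) ^ card {..<M'}"
        proof (rule M'[THEN spec, THEN spec, THEN spec, THEN mp], intro conjI)
          show "\<forall>b\<in>L. insensitive b z ?K {..<M'} {u \<in> ?C. subst I w u \<in> D b}"
            using D by (auto intro: insensitive_subst[OF _ w])
          show "\<forall>x\<in>?C. F (subst I w x) \<le> 1" using F(1) subst_in_cube[OF w] by blast
          show "nonpos_on M ?K {..<M'} (\<lambda>u. F (subst I w u))"
            by (rule nonpos_on_subst[OF F(2) w])
        qed auto
        also have "{u \<in> ?C. \<exists>b\<in>L. u \<notin> {u \<in> ?C. subst I w u \<in> D b}} = {u \<in> ?C. subst I w u \<in> E}"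
          using subst_in_cube[OF w] by (auto simp: E_def)
        also have "(\<Sum>u\<in>{u \<in> ?C. subst I w u \<in> E}. F (subst I w u)) =
          (\<Sum>u\<in>?C. F (subst I w u) * of_bool (subst I w u \<in> E))"
          using finC by (simp add: of_bool_def if_distrib[of "\<lambda>u. _ * u"] sum.If_cases Int_def cong: if_cong)
        finally show "(\<Sum>u\<in>?C. F (subst I w u) * of_bool (subst I w u \<in> E) - \<eta> / 3) \<le> 0"
          by (simp add: sum_subtractf card_PiE mult.commute)
      qed
    qed
    then have "(\<Sum>x\<in>D a. F x * of_bool (x \<in> E)) \<le> \<eta> / 3 * q ^ card I + \<eta> / 3 * card (D a)"
      by (simp add: sum_subtractf mult.commute)
    also have "\<dots> \<le> \<eta> / 3 * q ^ card I + \<eta> / 3 * q ^ card I"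
    proof -
      have "real (card (D a)) \<le> q ^ card I"
        using card_mono[OF finI Dsub] card_cube[OF I(1), of ?K] unfolding q_def by linarith
      then show ?thesis using \<eta> by (intro add_left_mono mult_left_mono) auto
    qed
    finally have 2: "(\<Sum>x\<in>D a. F x * of_bool (x \<in> E)) \<le> 2 * (\<eta> / 3 * q ^ card I)" by simp
    have finD: "finite (D a)" using Dsub finI finite_subset by blast
    have "{x \<in> cube I ?K. \<exists>b\<in>insert a L. x \<notin> D b} = (cube I ?K - D a) \<union> {x \<in> D a. x \<in> E}"
      using Dsub by (auto simp: E_def)
    then have "(\<Sum>x\<in>{x \<in> cube I ?K. \<exists>b\<in>insert a L. x \<notin> D b}. F x) =
      (\<Sum>x\<in>cube I ?K - D a. F x) + (\<Sum>x\<in>{x \<in> D a. x \<in> E}. F x)"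
      using finI finD by (simp only:) (rule sum.union_disjoint, auto)
    also have "(\<Sum>x\<in>{x \<in> D a. x \<in> E}. F x) = (\<Sum>x\<in>D a. F x * of_bool (x \<in> E))"
      using finD by (simp add: of_bool_def if_distrib[of "\<lambda>u. _ * u"] sum.If_cases Int_def cong: if_cong)
    finally show "(\<Sum>x\<in>{x \<in> cube I ?K. \<exists>b\<in>insert a L. x \<notin> D b}. F x) \<le> \<eta> * real (card ?K) ^ card I"
      using 1 2 unfolding q_def by linarith
  qed
qed

section \<open>The density Hales--Jewett theorem\<close>

lemma has_line_subst:
  assumes "has_line K J {u \<in> cube J K. subst I w u \<in> A}" "subspace_word K J I w"
  shows "has_line K I A"
proof -
  obtain S x where S: "S \<subseteq> J" "S \<noteq> {}" "\<And>a. a \<in> K \<Longrightarrow> subst I w (mrg S (\<lambda>_. a) x) \<in> A"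
    using assms(1) unfolding has_line_def by blast
  define S' where "S' = {i \<in> I. \<exists>j\<in>S. w i = Inr j}"
  have "mrg S' (\<lambda>_. a) (subst I w x) = subst I w (mrg S (\<lambda>_. a) x)" for a
  proof
    fix i show "mrg S' (\<lambda>_. a) (subst I w x) i = subst I w (mrg S (\<lambda>_. a) x) i"
      by (cases "w i") (auto simp: mrg_def subst_def S'_def)
  qed
  moreover have "S' \<noteq> {}"
  proof -
    obtain j where j: "j \<in> S" using S by auto
    then have "Inr j \<in> w ` I" using S(1) assms(2) unfolding subspace_word_def by blast
    then obtain i where "i \<in> I" "w i = Inr j" by (metis imageE)
    then show ?thesis using j by (auto simp: S'_def)
  qed
  ultimately show ?thesis unfolding has_line_def using S(3)
    by (intro exI[of _ S'] exI[of _ "subst I w x"]) (auto simp: S'_def)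
qed

text \<open>
  The map \<open>mrg {i \<in> I. u i = z} (\<lambda>_. a) u\<close> replaces the letter \<open>z\<close> by \<open>a\<close>: reading \<open>z\<close> as a wildcard,
  \<open>u\<close> is a line over \<open>K\<close>, and this is its point with parameter \<open>a\<close>.
\<close>

lemma line_free_card_le:
  assumes "DHJ K" "finite K" "z \<notin> K" "0 < \<eta>" "0 \<le> \<kappa>"
  shows "\<exists>d. \<forall>I B. finite I \<and> d \<le> card I \<and> B \<subseteq> cube I (insert z K) \<and> \<not> has_line (insert z K) I B \<and>
    (\<forall>w. subspace_word (insert z K) {..<M} I w \<longrightarrow>
      card {u \<in> cube {..<M} (insert z K). subst I w u \<in> B} \<le> \<kappa> * real (card (insert z K)) ^ M) \<longrightarrow>
    card B \<le> \<kappa> * (real (card (insert z K)) ^ card I -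
         card {u \<in> cube I (insert z K). \<forall>a\<in>K. mrg {i \<in> I. u i = z} (\<lambda>_. a) u \<in> B}) +
       \<eta> * real (card (insert z K)) ^ card I"
proof -
  let ?K = "insert z K"
  define k where "k = real (card K)"
  define q where "q = real (card ?K)"
  have q: "q = k + 1" "0 \<le> k" using assms by (auto simp: q_def k_def)
  have \<eta>: "0 < \<eta> / 2" using assms by simp
  from sum_not_all_insensitive_le[OF assms(1-3) assms(2) subset_refl \<eta>, of M] obtain d1 where
    d1: "\<forall>I D F. finite I \<and> d1 \<le> card I \<and> (\<forall>a\<in>K. insensitive a z ?K I (D a)) \<and>
    (\<forall>x\<in>cube I ?K. F x \<le> 1) \<and> nonpos_on M ?K I F \<longrightarrow>
    (\<Sum>x\<in>{x \<in> cube I ?K. \<exists>a\<in>K. x \<notin> D a}. F x) \<le> \<eta> / 2 * q ^ card I" 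
    unfolding q_def ..
  \<comment> \<open>Words avoiding \<open>z\<close> are a proportion \<open>(k / q) ^ card I\<close>
    of the cube, which becomes negligible.\<close>
  obtain d2 where d2: "(k / q) ^ d2 < \<eta> / 2"
    using real_arch_pow_inv[of "\<eta> / 2" "k / q"] \<eta> q by auto
  show ?thesis
  proof (intro exI[of _ "max d1 d2"] allI impI, elim conjE)
    fix I B assume I: "finite I" "max d1 d2 \<le> card I" and B: "B \<subseteq> cube I ?K"
      and lf: "\<not> has_line ?K I B"
      and sub: "\<forall>w. subspace_word ?K {..<M} I w \<longrightarrow>
      card {u \<in> cube {..<M} ?K. subst I w u \<in> B} \<le> \<kappa> * real (card ?K) ^ M"
    define R where "R a u = mrg {i \<in> I. u i = z} (\<lambda>_. a) u" for a and u :: "nat \<Rightarrow> 'a"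
    define D where "D = {u \<in> cube I ?K. \<forall>a\<in>K. R a u \<in> B}"
    have finI: "finite (cube I ?K)" using I assms by (intro finite_cube) auto
    have finB: "finite B" "finite D" using B finI finite_subset by (auto simp: D_def)
    \<comment> \<open>\<open>R a\<close> turns every \<open>z\<close> into \<open>a\<close> and
      keeps every \<open>a\<close>, so it cannot tell the two apart.\<close>
    have "insensitive a z ?K I {u \<in> cube I ?K. R a u \<in> B}" if a: "a \<in> K" for a
      unfolding insensitive_def
    proof (intro conjI ballI impI)
      fix x y assume x: "x \<in> {u \<in> cube I ?K. R a u \<in> B}" and y: "y \<in> cube I ?K"
        and xy: "\<forall>i\<in>I. x i = y i \<or> x i \<in> {a, z} \<and> y i \<in> {a, z}"
      have "R a x = R a y"
      proof
        fix i show "R a x i = R a y i"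
        proof (cases "i \<in> I")
          case True then show ?thesis using xy by (auto simp: R_def mrg_def)
        next
          case False then show ?thesis
            using x y PiE_arb[of x I "\<lambda>_. ?K" i] PiE_arb[of y I "\<lambda>_. ?K" i] by (auto simp: R_def mrg_def)
        qed
      qed
      then show "y \<in> {u \<in> cube I ?K. R a u \<in> B}" using x y by auto
    qed auto
    moreover have "\<forall>x\<in>cube I ?K. of_bool (x \<in> B) - \<kappa> \<le> (1::real)"
      using assms(5) by (auto simp: of_bool_def)
    moreover have "nonpos_on M ?K I (\<lambda>x. of_bool (x \<in> B) - \<kappa>)"
      unfolding nonpos_on_def
    proof (intro allI impI)
      fix w assume "subspace_word ?K {..<M} I w"
      then have "card {u \<in> cube {..<M} ?K. subst I w u \<in> B} \<le> \<kappa> * real (card ?K) ^ M"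
        using sub by blast
      moreover have "finite (cube {..<M} ?K)" using assms by (intro finite_cube) auto
      ultimately show "(\<Sum>u\<in>cube {..<M} ?K. of_bool (subst I w u \<in> B) - \<kappa>) \<le> 0"
        using card_cube[of "{..<M}" ?K]
        by (simp add: sum_subtractf card_Collect_eq_sum_of_bool[symmetric] mult.commute
          del: card_PiE sum_of_bool_eq)
    qed
    ultimately have "(\<Sum>x\<in>{x \<in> cube I ?K. \<exists>a\<in>K. x \<notin> {u \<in> cube I ?K. R a u \<in> B}}. of_bool (x \<in> B) - \<kappa>) \<le>
      \<eta> / 2 * q ^ card I"
      using I by (intro d1[THEN spec, THEN spec, THEN spec, THEN mp] conjI) auto
    also have "{x \<in> cube I ?K. \<exists>a\<in>K. x \<notin> {u \<in> cube I ?K. R a u \<in> B}} = cube I ?K - D"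
      by (auto simp: D_def)
    also have "(\<Sum>x\<in>cube I ?K - D. of_bool (x \<in> B) - \<kappa>) = card (B - D) - \<kappa> * (q ^ card I - card D)"
    proof -
      have "(cube I ?K - D) \<inter> B = B - D" using B by auto
      moreover have "card (cube I ?K - D) = card (cube I ?K) - card D"
        using finB by (intro card_Diff_subset) (auto simp: D_def)
      moreover have "card D \<le> card (cube I ?K)" using finI by (intro card_mono) (auto simp: D_def)
      ultimately show ?thesis
        using finI card_cube[OF I(1), of ?K]
        by (simp add: sum_subtractf of_nat_diff q_def mult.commute del: card_PiE)
    qed
    finally have 1: "card (B - D) \<le> \<kappa> * (q ^ card I - card D) + \<eta> / 2 * q ^ card I" by simp
    \<comment> \<open>A word of \<open>D\<close> containing \<open>z\<close> is a line whose points
      with parameter in \<open>K\<close> lie in \<open>B\<close>. It is itself the point with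
      parameter \<open>z\<close>, so in \<open>B\<close> it would complete a line.\<close>
    have "B \<inter> D \<subseteq> cube I K"
    proof
      fix u assume u: "u \<in> B \<inter> D"
      have "{i \<in> I. u i = z} = {}"
      proof (rule ccontr)
        assume ne: "{i \<in> I. u i = z} \<noteq> {}"
        have "R z u = u" by (auto simp: R_def mrg_def)
        then have "\<forall>a\<in>?K. R a u \<in> B" using u by (auto simp: D_def)
        then have "has_line ?K I B" unfolding has_line_def R_def using ne
          by (intro exI[of _ "{i \<in> I. u i = z}"] exI[of _ u]) auto
        with lf show False ..
      qed
      moreover have "u \<in> cube I ?K" using u B by blast
      ultimately show "u \<in> cube I K" by (auto simp: PiE_iff)
    qed
    then have "card (B \<inter> D) \<le> card (cube I K)"
      using finite_cube[OF I(1) assms(2)] by (rule card_mono[rotated])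
    then have "card (B \<inter> D) \<le> k ^ card I"
      unfolding k_def card_cube[OF I(1), symmetric] by (rule of_nat_mono)
    also have "\<dots> = (k / q) ^ card I * q ^ card I" using q by (simp add: power_divide)
    also have "\<dots> \<le> \<eta> / 2 * q ^ card I"
    proof (rule mult_right_mono)
      have "(k / q) ^ card I \<le> (k / q) ^ d2" using I q by (intro power_decreasing) auto
      then show "(k / q) ^ card I \<le> \<eta> / 2" using d2 by linarith
    qed (use q in auto)
    finally have 2: "card (B \<inter> D) \<le> \<eta> / 2 * q ^ card I" .
    have "card B = card (B - D) + card (B \<inter> D)"
      using card_Int_Diff[OF finB(1), of D] by simp
    then show "card B \<le> \<kappa> * (real (card ?K) ^ card I -
         card {u \<in> cube I ?K. \<forall>a\<in>K. mrg {i \<in> I. u i = z} (\<lambda>_. a) u \<in> B}) + \<eta> * real (card ?K) ^ card I"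
      using 1 2 unfolding D_def R_def q_def[symmetric] by simp
  qed
qed

text \<open>
  A random word \<open>b\<close> over the symbols \<open>K \<times> {..<m} + {..<m}\<close> embeds \<open>cube {..<m} K\<close> into \<open>cube I K\<close>;
  for every choice of \<open>b\<close>, many \<open>y\<close> have a line of the embedded cube in \<open>A y\<close>, so some fixed line \<open>v\<close>
  of the small cube is good on average. The image of \<open>v\<close> is a random word over \<open>insert z K\<close>, in which
  \<open>z\<close> is the rarest letter; hence its distribution is a mixture of uniform distributions on fibres
  \<open>cube J (insert z K)\<close> with the remaining letters fixed in \<open>K\<close>. This replaces the Graham--Rothschild
  theorem.
\<close>

lemma exists_line_rich_fibre:
  fixes K :: "'a set" and \<delta> :: real
  assumes DHJ: "DHJ K" and K: "finite K" "K \<noteq> {}" "z \<notin> K" and \<delta>: "0 < \<delta>"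
  shows "\<exists>\<theta>>0. \<forall>d. \<exists>N. \<forall>(I :: nat set) Y A. finite I \<and> N \<le> card I \<and> finite (Y :: 'y set) \<and> Y \<noteq> {} \<and>
    (\<forall>x\<in>cube I (insert z K). \<delta> * card Y \<le> card {y \<in> Y. x \<in> A y}) \<longrightarrow>
    (\<exists>J e. J \<subseteq> I \<and> d \<le> card J \<and> e \<in> cube (I - J) K \<and>
      \<theta> * real (card (insert z K)) ^ card J * card Y \<le>
      (\<Sum>u\<in>cube J (insert z K).
         real (card {y \<in> Y. \<forall>a\<in>K. mrg J (mrg {i \<in> J. u i = z} (\<lambda>_. a) u) e \<in> A y})))"
proof -
  let ?K = "insert z K"
  define k where "k = card K"
  define q where "q = real (card ?K)"
  have k: "0 < k" and qk: "card ?K = Suc k" using K by (auto simp: k_def card_gt_0_iff)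
  have q: "1 \<le> q" by (simp add: q_def qk)
  have \<delta>2: "0 < \<delta> / 2" using \<delta> by simp
  then obtain m0 where m0: "\<And>I A. finite I \<Longrightarrow> m0 \<le> card I \<Longrightarrow> A \<subseteq> cube I K \<Longrightarrow>
     \<delta> / 2 * real k ^ card I \<le> card A \<Longrightarrow> has_line K I A"
    using DHJ unfolding DHJ_def k_def by meson
  \<comment> \<open>The successor makes \<open>m\<close> positive, so that \<Sigma> is
    nonempty.\<close>
  define m where "m = Suc m0"
  \<comment> \<open>The average \<open>\<delta> / 2\<close> is shared among at most
    \<open>q ^ m\<close> lines, and the passage to a fibre costs another factor 2.\<close>
  define \<theta> where "\<theta> = \<delta> / 4 / q ^ m"
  have \<theta>: "0 < \<theta>" using \<delta> q by (simp add: \<theta>_def)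
  \<comment> \<open>\<open>Inr j\<close> copies coordinate \<open>j\<close> of the small cube,
    \<open>Inl (a, j)\<close> is one of \<open>m\<close> copies of the fixed letter
    \<open>a\<close>. A word \<open>v\<close> contains \<open>z\<close> at most \<open>m\<close>
    times, so the copies make every letter of \<open>K\<close> at least as frequent as
    \<open>z\<close>.\<close>
  define \<Sigma> :: "('a \<times> nat + nat) set" where "\<Sigma> = Inl ` (K \<times> {..<m}) \<union> Inr ` {..<m}"
  have \<Sigma>: "finite \<Sigma>" "\<Sigma> \<noteq> {}" using K by (auto simp: \<Sigma>_def m_def)
  define \<rho> :: "(nat \<Rightarrow> 'a) \<Rightarrow> 'a \<times> nat + nat \<Rightarrow> 'a" where "\<rho> v = case_sum fst v" for v
  \<comment> \<open>With \<open>z\<close> read as a wildcard, these are the lines of the small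
    cube.\<close>
  define V where "V = {v \<in> cube {..<m} ?K. \<exists>j<m. v j = z}"
  have finc: "finite (cube {..<m} ?K)" "finite (cube {..<m} K)" using K by (auto intro!: finite_cube)
  have finV: "finite V" using finc by (simp add: V_def)
  have cV: "real (card V) \<le> q ^ m"
    using card_mono[OF finc(1), of V] card_cube[of "{..<m}" ?K] unfolding V_def q_def
    by (simp del: card_PiE)
  show ?thesis
  proof (intro exI[of _ \<theta>] conjI \<theta> allI)
    fix d
    obtain N where N: "\<And>I Z. finite (I::nat set) \<Longrightarrow> N \<le> card I \<Longrightarrow> Z \<subseteq> \<Sigma> \<Longrightarrow> Z \<noteq> {} \<Longrightarrow>
      card {b \<in> cube I \<Sigma>. card {i \<in> I. b i \<in> Z} < d} < \<theta> * real (card \<Sigma>) ^ card I"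
      using few_hits_rare[OF \<Sigma>(1) \<theta>, of d, where 'i = nat] by meson
    show "\<exists>N. \<forall>(I :: nat set) Y A. finite I \<and> N \<le> card I \<and> finite (Y :: 'y set) \<and> Y \<noteq> {} \<and>
      (\<forall>x\<in>cube I ?K. \<delta> * card Y \<le> card {y \<in> Y. x \<in> A y}) \<longrightarrow>
      (\<exists>J e. J \<subseteq> I \<and> d \<le> card J \<and> e \<in> cube (I - J) K \<and>
        \<theta> * real (card ?K) ^ card J * card Y \<le>
        (\<Sum>u\<in>cube J ?K.
           real (card {y \<in> Y. \<forall>a\<in>K. mrg J (mrg {i \<in> J. u i = z} (\<lambda>_. a) u) e \<in> A y})))"
    proof (intro exI[of _ N] allI impI, elim conjE)
      fix I :: "nat set" and Y :: "'y set" and A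
      assume I: "finite I" "N \<le> card I" and Y: "finite Y" "Y \<noteq> {}"
        and dense: "\<forall>x\<in>cube I ?K. \<delta> * card Y \<le> card {y \<in> Y. x \<in> A y}"
      define H where "H x = {y \<in> Y. \<forall>a\<in>K. mrg {i \<in> I. x i = z} (\<lambda>_. a) x \<in> A y}"
        for x :: "nat \<Rightarrow> 'a"
      define h where "h x = real (card (H x))" for x
      define E where "E b v = (\<lambda>i\<in>I. \<rho> v (b i))" for b :: "nat \<Rightarrow> 'a \<times> nat + nat" and v
      have hle: "h x \<le> card Y" for x
        unfolding h_def H_def using Y by (simp add: card_mono)
      have lines: "\<delta> / 2 * card Y \<le> (\<Sum>v\<in>V. h (E b v))" if b: "b \<in> cube I \<Sigma>" for b
      proof -
        have Eb: "E b v \<in> cube I L" if "v \<in> cube {..<m} L" "K \<subseteq> L" for v L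
        proof (rule PiE_I)
          fix i assume "i \<in> I"
          then have "b i \<in> \<Sigma>" using b by auto
          then show "E b v i \<in> L" using \<open>i \<in> I\<close> that by (auto simp: E_def \<rho>_def \<Sigma>_def)
        qed (simp add: E_def)
        define g where "g y = real (card {u \<in> cube {..<m} K. E b u \<in> A y})" for y
        define G where "G = {y \<in> Y. \<delta> / 2 * real k ^ m \<le> g y}"
        have ck: "real (card (cube {..<m} K)) = real k ^ m"
          using card_cube[of "{..<m}" K] by (simp add: k_def del: card_PiE)
        have G_ge: "\<delta> / 2 * card Y \<le> card G"
          unfolding G_def
        proof (rule card_ge_half)
          show "g y \<le> real k ^ m" for y
            unfolding g_def ck[symmetric] using finc by (simp add: card_mono del: card_PiE)
          have "real k ^ m * (\<delta> * card Y) = (\<Sum>u\<in>cube {..<m} K. \<delta> * card Y)"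
            using ck by (simp del: card_PiE)
          also have "\<dots> \<le> (\<Sum>u\<in>cube {..<m} K. real (card {y \<in> Y. E b u \<in> A y}))"
          proof (rule sum_mono)
            fix u assume "u \<in> cube {..<m} K"
            then have "u \<in> cube {..<m} ?K" by (auto simp: PiE_iff)
            then have "E b u \<in> cube I ?K" by (intro Eb) auto
            then show "\<delta> * card Y \<le> real (card {y \<in> Y. E b u \<in> A y})" using dense by blast
          qed
          also have "\<dots> = sum g Y"
            unfolding g_def card_Collect_eq_sum_of_bool[OF Y(1)] card_Collect_eq_sum_of_bool[OF finc(2)]
            by (rule sum.swap)
          finally show "real k ^ m * (\<delta> * card Y) \<le> sum g Y" .
        qed (use Y \<delta> k in auto)
        have "G \<subseteq> (\<Union>v\<in>V. H (E b v))"
        proof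
          fix y assume y: "y \<in> G"
          have "has_line K {..<m} {u \<in> cube {..<m} K. E b u \<in> A y}"
            using y by (intro m0) (auto simp: G_def g_def m_def)
          then obtain S x where S: "S \<subseteq> {..<m}" "S \<noteq> {}" and
            Sx: "\<And>a. a \<in> K \<Longrightarrow> mrg S (\<lambda>_. a) x \<in> cube {..<m} K \<and> E b (mrg S (\<lambda>_. a) x) \<in> A y"
            unfolding has_line_def by blast
          obtain a0 where a0: "a0 \<in> K" using K by auto
          have in0: "mrg S (\<lambda>_. a0) x \<in> cube {..<m} K" using Sx[OF a0] by blast
          have xK: "x j \<in> K" if "j < m" "j \<notin> S" for j
            using PiE_mem[OF in0, of j] that by (simp add: mrg_def)
          define v where "v = mrg S (\<lambda>_. z) x"
          have "v \<in> cube {..<m} ?K"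
          proof (rule PiE_I)
            fix j assume "j \<in> {..<m}" then show "v j \<in> ?K" using xK by (auto simp: v_def mrg_def)
          next
            fix j assume "j \<notin> {..<m}" then show "v j = undefined"
              using PiE_arb[OF in0, of j] S(1) by (auto simp: v_def mrg_def)
          qed
          moreover have "\<exists>j<m. v j = z" using S by (auto simp: v_def mrg_def)
          ultimately have "v \<in> V" by (simp add: V_def)
          moreover have "mrg {i \<in> I. E b v i = z} (\<lambda>_. a) (E b v) = E b (mrg S (\<lambda>_. a) x)"
            if a: "a \<in> K" for a
          proof
            fix i show "mrg {i \<in> I. E b v i = z} (\<lambda>_. a) (E b v) i = E b (mrg S (\<lambda>_. a) x) i"
            proof (cases "i \<in> I")
              case True
              then have "b i \<in> \<Sigma>" using b by auto
              then show ?thesis using True K(3) xK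
                by (auto simp: \<Sigma>_def E_def \<rho>_def v_def mrg_def)
            qed (simp add: mrg_def E_def)
          qed
          then have "y \<in> H (E b v)" using Sx y by (simp add: H_def G_def)
          ultimately show "y \<in> (\<Union>v\<in>V. H (E b v))" by blast
        qed
        then have "card G \<le> card (\<Union>v\<in>V. H (E b v))"
          using finV Y by (intro card_mono) (auto simp: H_def)
        also have "\<dots> \<le> (\<Sum>v\<in>V. card (H (E b v)))" using finV by (rule card_UN_le)
        finally have "real (card G) \<le> (\<Sum>v\<in>V. h (E b v))"
          unfolding h_def by (simp only: of_nat_sum[symmetric] of_nat_le_iff)
        with G_ge show ?thesis by linarith
      qed
      have cY: "0 < real (card Y)" using Y by (simp add: card_gt_0_iff)
      define s where "s = real (card \<Sigma>)"
      have s: "0 < s" using \<Sigma> by (simp add: s_def card_gt_0_iff)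
      have finS: "finite (cube I \<Sigma>)" using I \<Sigma> by (intro finite_cube)
      have cS: "real (card (cube I \<Sigma>)) = s ^ card I" unfolding s_def by (rule card_cube[OF I(1)])
      have "\<exists>v\<in>V. 2 * \<theta> * s ^ card I * card Y \<le> (\<Sum>b\<in>cube I \<Sigma>. h (E b v))"
      proof (rule ccontr)
        assume neg: "\<not> ?thesis"
        have "s ^ card I * (\<delta> / 2 * card Y) = (\<Sum>b\<in>cube I \<Sigma>. \<delta> / 2 * card Y)"
          using cS by (simp del: card_PiE)
        also have "\<dots> \<le> (\<Sum>b\<in>cube I \<Sigma>. \<Sum>v\<in>V. h (E b v))" by (intro sum_mono lines)
        also have "\<dots> = (\<Sum>v\<in>V. \<Sum>b\<in>cube I \<Sigma>. h (E b v))" by (rule sum.swap)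
        finally have *: "s ^ card I * (\<delta> / 2 * card Y) \<le> (\<Sum>v\<in>V. \<Sum>b\<in>cube I \<Sigma>. h (E b v))" .
        have "0 < s ^ card I * (\<delta> / 2 * card Y)" using s \<delta> cY by simp
        then have "V \<noteq> {}" using * by auto
        then have "(\<Sum>v\<in>V. \<Sum>b\<in>cube I \<Sigma>. h (E b v)) < (\<Sum>v\<in>V. 2 * \<theta> * s ^ card I * card Y)"
          using neg finV by (intro sum_strict_mono) (auto simp: not_le)
        also have "\<dots> = real (card V) * (2 * \<theta> * s ^ card I * card Y)" by simp
        also have "\<dots> \<le> q ^ m * (2 * \<theta> * s ^ card I * card Y)"
          using cV \<theta> s by (intro mult_right_mono) auto
        also have "\<dots> = s ^ card I * (\<delta> / 2 * card Y)"
          using q by (simp add: \<theta>_def field_simps)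
        finally show False using * by linarith
      qed
      then obtain v where v: "v \<in> V" and
        avg: "2 * \<theta> * s ^ card I * card Y \<le> (\<Sum>b\<in>cube I \<Sigma>. h (E b v))" by blast
      define T where "T = {j. j < m \<and> v j = z}"
      define t where "t = card T"
      have T: "finite T" "T \<noteq> {}" "T \<subseteq> {..<m}" using v by (auto simp: T_def V_def)
      have tm: "t \<le> m" using card_mono[OF _ T(3)] by (simp add: t_def)
      \<comment> \<open>A balanced set: each letter of \<open>?K\<close> is the value of exactly
        \<open>t\<close> symbols in \<open>Z\<close>, namely the coordinates in \<open>T\<close> for
        \<open>z\<close> and \<open>t\<close> of the \<open>m\<close> copies for a letter of
        \<open>K\<close>. All symbols with value \<open>z\<close> are in \<open>Z\<close>, so
        letters fixed outside it belong to \<open>K\<close>.\<close>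
      define Z where "Z = (Inl ` (K \<times> {..<t}) \<union> Inr ` T :: ('a \<times> nat + nat) set)"
      have Z: "Z \<subseteq> \<Sigma>" "Z \<noteq> {}" using T tm by (auto simp: Z_def \<Sigma>_def)
      have finZ: "finite Z" using Z \<Sigma> finite_subset by blast
      have fibres: "card {s \<in> Z. \<rho> v s = a} = t" if "a \<in> ?K" for a
      proof (cases "a = z")
        case True
        have "{s \<in> Z. \<rho> v s = a} = Inr ` T" using K(3) True by (auto simp: Z_def \<rho>_def T_def)
        then show ?thesis by (simp add: card_image t_def)
      next
        case False
        then have "{s \<in> Z. \<rho> v s = a} = Inl ` ({a} \<times> {..<t})"
          using that by (auto simp: Z_def \<rho>_def T_def)
        then show ?thesis by (simp add: card_image card_cartesian_product)
      qed
      have cZ: "card Z = t * card ?K"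
      proof -
        have "card Z = card (Inl ` (K \<times> {..<t}) :: ('a \<times> nat + nat) set) + card (Inr ` T :: ('a \<times> nat + nat) set)"
          unfolding Z_def using K T by (intro card_Un_disjoint) auto
        then show ?thesis by (simp add: card_image card_cartesian_product qk t_def k_def)
      qed
      have "\<exists>J c. J \<subseteq> I \<and> d \<le> card J \<and> c \<in> cube (I - J) (\<Sigma> - Z) \<and>
           \<theta> * real (card Z) ^ card J \<le> (\<Sum>b\<in>cube J Z. h (E (mrg J b c) v) / card Y)"
      proof (rule exists_dense_fibre[OF I(1) \<Sigma>(1) Z(1)])
        show "h (E b v) / card Y \<le> 1" for b
          using hle[of "E b v"] cY by (simp add: divide_le_eq)
        show "card {b \<in> cube I \<Sigma>. card {i \<in> I. b i \<in> Z} < d} < \<theta> * real (card \<Sigma>) ^ card I"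
          by (rule N[OF I Z])
        show "2 * \<theta> * real (card \<Sigma>) ^ card I \<le> (\<Sum>b\<in>cube I \<Sigma>. h (E b v) / card Y)"
          using avg cY unfolding s_def sum_divide_distrib[symmetric]
          by (simp add: pos_le_divide_eq)
      qed (use \<theta> in auto)
      then obtain J c where J: "J \<subseteq> I" "d \<le> card J" and c: "c \<in> cube (I - J) (\<Sigma> - Z)" and
        rich: "\<theta> * real (card Z) ^ card J \<le> (\<Sum>b\<in>cube J Z. h (E (mrg J b c) v) / card Y)" by blast
      define e where "e = (\<lambda>i\<in>I - J. \<rho> v (c i))"
      have e: "e \<in> cube (I - J) K"
      proof (rule PiE_I)
        fix i assume i: "i \<in> I - J"
        then have "c i \<in> \<Sigma> - Z" using c by auto
        then show "e i \<in> K" using i v by (auto simp: e_def \<rho>_def \<Sigma>_def Z_def T_def V_def PiE_iff)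
      qed (auto simp: e_def)
      have Emrg: "E (mrg J b c) v = mrg J (\<lambda>i\<in>J. \<rho> v (b i)) e" for b
        using J(1) by (auto simp: E_def mrg_def e_def fun_eq_iff)
      have Hmrg: "H (mrg J u e) = {y \<in> Y. \<forall>a\<in>K. mrg J (mrg {i \<in> J. u i = z} (\<lambda>_. a) u) e \<in> A y}" for u
      proof -
        have "mrg {i \<in> I. mrg J u e i = z} (\<lambda>_. a) (mrg J u e) = mrg J (mrg {i \<in> J. u i = z} (\<lambda>_. a) u) e" for a
        proof
          fix i
          show "mrg {i \<in> I. mrg J u e i = z} (\<lambda>_. a) (mrg J u e) i = mrg J (mrg {i \<in> J. u i = z} (\<lambda>_. a) u) e i"
            using J(1) K(3) PiE_mem[OF e, of i] by (auto simp: mrg_def)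
        qed
        then show ?thesis by (simp add: H_def)
      qed
      have finJ: "finite J" using J(1) I(1) finite_subset by auto
      \<comment> \<open>Both sides acquire the factor \<open>real t ^ card J\<close>, which is
        positive because \<open>T\<close> is nonempty and so cancels.\<close>
      have "real t ^ card J * (\<theta> * q ^ card J) = \<theta> * real (card Z) ^ card J"
        by (simp add: cZ q_def power_mult_distrib)
      also have "\<dots> \<le> (\<Sum>b\<in>cube J Z. h (mrg J (\<lambda>i\<in>J. \<rho> v (b i)) e) / card Y)"
        using rich by (simp add: Emrg)
      also have "\<dots> = real t ^ card J * (\<Sum>u\<in>cube J ?K. h (mrg J u e) / card Y)"
      proof (rule sum_cube_map[where h = "\<lambda>u. h (mrg J u e) / card Y"])
        show "\<rho> v ` Z \<subseteq> ?K" by (auto simp: Z_def \<rho>_def T_def)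
      qed (rule finJ finZ fibres finite.insertI K | assumption)+
      finally have "\<theta> * q ^ card J \<le> (\<Sum>u\<in>cube J ?K. h (mrg J u e) / card Y)"
        using T by (simp add: t_def card_gt_0_iff)
      then have "\<theta> * q ^ card J * card Y \<le> (\<Sum>u\<in>cube J ?K. h (mrg J u e))"
        using cY unfolding sum_divide_distrib[symmetric] by (simp add: pos_le_divide_eq)
      then show "\<exists>J e. J \<subseteq> I \<and> d \<le> card J \<and> e \<in> cube (I - J) K \<and>
        \<theta> * real (card ?K) ^ card J * card Y \<le>
        (\<Sum>u\<in>cube J ?K.
           real (card {y \<in> Y. \<forall>a\<in>K. mrg J (mrg {i \<in> J. u i = z} (\<lambda>_. a) u) e \<in> A y}))"
        using J e unfolding h_def Hmrg q_def by blast
    qed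
  qed
qed

section \<open>Critical density\<close>

definition line_free_bound :: "'a set \<Rightarrow> real \<Rightarrow> bool" where
  "line_free_bound K c \<longleftrightarrow> (\<exists>n. \<forall>I A. finite I \<and> n \<le> card I \<and> A \<subseteq> cube I K \<and> \<not> has_line K I A \<longrightarrow>
     card A \<le> c * real (card K) ^ card I)"

lemma line_free_bound_mono: "line_free_bound K c \<Longrightarrow> c \<le> c' \<Longrightarrow> line_free_bound K c'"
  unfolding line_free_bound_def
  by (meson order_trans mult_right_mono of_nat_0_le_iff zero_le_power)

text \<open>\<delta> is the infimum of all \<open>c\<close> with \<open>line_free_bound K c\<close>.
  These bounds are upward closed, and a density at which \<open>DHJ K\<close> fails is a positive
  lower bound for them.\<close>

lemma critical_density:
  assumes "finite K" "K \<noteq> {}" "\<not> DHJ K"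
  shows "\<exists>\<delta>>0. \<forall>\<epsilon>>0. line_free_bound K (\<delta> + \<epsilon>) \<and> \<not> line_free_bound K (\<delta> - \<epsilon>)"
proof -
  have "\<exists>\<delta>>0. \<forall>N. \<exists>I A. finite I \<and> N \<le> card I \<and> A \<subseteq> cube I K \<and>
     \<delta> * real (card K) ^ card I \<le> card A \<and> \<not> has_line K I A"
    using assms(3) unfolding DHJ_def not_all not_ex not_imp conj_assoc .
  then obtain \<delta>0 where \<delta>0: "0 < \<delta>0" "\<And>N. \<exists>I A. finite I \<and> N \<le> card I \<and> A \<subseteq> cube I K \<and>
     \<delta>0 * real (card K) ^ card I \<le> card A \<and> \<not> has_line K I A"
    by meson
  have k: "0 < real (card K)" using assms by (simp add: card_gt_0_iff)
  define C where "C = {c. line_free_bound K c}"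
  have "line_free_bound K 1"
    unfolding line_free_bound_def
  proof (intro exI[of _ 0] allI impI, elim conjE)
    fix I A assume "finite I" "A \<subseteq> cube I K"
    then have "card A \<le> card (cube I K)" using assms by (intro card_mono finite_cube)
    then show "card A \<le> 1 * real (card K) ^ card I"
      using card_cube[OF \<open>finite I\<close>, of K] by linarith
  qed
  then have ne: "C \<noteq> {}" by (auto simp: C_def)
  have lower: "\<delta>0 \<le> c" if c: "c \<in> C" for c
  proof -
    obtain n where n: "\<And>I A. finite I \<Longrightarrow> n \<le> card I \<Longrightarrow> A \<subseteq> cube I K \<Longrightarrow> \<not> has_line K I A \<Longrightarrow>
      card A \<le> c * real (card K) ^ card I"
      using c unfolding C_def line_free_bound_def by blast
    obtain I A where I: "finite I" "n \<le> card I" "A \<subseteq> cube I K" "\<not> has_line K I A"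
      and A: "\<delta>0 * real (card K) ^ card I \<le> card A"
      using \<delta>0(2)[of n] by blast
    have "\<delta>0 * real (card K) ^ card I \<le> c * real (card K) ^ card I"
      using n[OF I] A by linarith
    then show ?thesis using k by simp
  qed
  have bdd: "bdd_below C" using lower by (auto simp: bdd_below_def)
  have "\<delta>0 \<le> Inf C" using ne lower by (rule cInf_greatest)
  then have "0 < Inf C" using \<delta>0 by linarith
  moreover have "line_free_bound K (Inf C + \<epsilon>)" if \<epsilon>: "0 < \<epsilon>" for \<epsilon>
  proof -
    obtain c where "c \<in> C" "c < Inf C + \<epsilon>"
      using cInf_lessD[OF ne, of "Inf C + \<epsilon>"] \<epsilon> by auto
    then show ?thesis using line_free_bound_mono[of K c] by (auto simp: C_def)
  qed
  moreover have "\<not> line_free_bound K (Inf C - \<epsilon>)" if "0 < \<epsilon>" for \<epsilon>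
    using cInf_lower[OF _ bdd, of "Inf C - \<epsilon>"] that by (auto simp: C_def)
  ultimately show ?thesis by blast
qed

text \<open>
  At the critical density \<open>\<delta>\<close>, a line-free set of density almost \<open>\<delta>\<close> has density almost \<open>\<delta>\<close> on every
  fibre. On the fibre found above the lines force a positive proportion of the words into a set that
  \<open>A\<close> hardly meets, while \<open>A\<close> has density at most \<open>\<delta> + \<epsilon>\<close> on the complement of that set.
\<close>

lemma DHJ_insert:
  fixes K :: "'a set"
  assumes DHJ: "DHJ K" and K: "finite K" "K \<noteq> {}" "z \<notin> K"
  shows "DHJ (insert z K)"
proof (rule ccontr)
  let ?K = "insert z K"
  assume "\<not> DHJ ?K"
  with K critical_density[of ?K] obtain \<delta> where \<delta>: "0 < \<delta>" and
    up: "\<And>\<epsilon>. 0 < \<epsilon> \<Longrightarrow> line_free_bound ?K (\<delta> + \<epsilon>)" and low: "\<And>\<epsilon>. 0 < \<epsilon> \<Longrightarrow> \<not> line_free_bound ?K (\<delta> - \<epsilon>)" by blast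
  define q where "q = real (card ?K)"
  have "1 \<le> card ?K" using K by (simp add: Suc_le_eq card_gt_0_iff)
  then have q: "1 \<le> q" unfolding q_def by linarith
  have \<delta>2: "0 < \<delta> / 2" using \<delta> by simp
  from exists_line_rich_fibre[OF DHJ K this, where 'y = "nat \<Rightarrow> 'a"] obtain \<theta> where \<theta>: "0 < \<theta>" and
    rich: "\<forall>d. \<exists>N. \<forall>(I :: nat set) Y A. finite I \<and> N \<le> card I \<and> finite (Y :: (nat \<Rightarrow> 'a) set) \<and> Y \<noteq> {} \<and>
    (\<forall>x\<in>cube I ?K. \<delta> / 2 * card Y \<le> card {y \<in> Y. x \<in> A y}) \<longrightarrow>
    (\<exists>J e. J \<subseteq> I \<and> d \<le> card J \<and> e \<in> cube (I - J) K \<and>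
      \<theta> * real (card ?K) ^ card J * card Y \<le>
      (\<Sum>u\<in>cube J ?K.
         real (card {y \<in> Y. \<forall>a\<in>K. mrg J (mrg {i \<in> J. u i = z} (\<lambda>_. a) u) e \<in> A y})))"
    by - (elim exE conjE, rule that)
  \<comment> \<open>The first bound keeps all fibres at density at least
    \<open>\<delta> / 2\<close>; the second contradicts the final inequality \<open>\<delta> *
    \<theta> + \<epsilon> * \<theta> \<le> 3 * \<epsilon>\<close>.\<close>
  define \<epsilon> where "\<epsilon> = min (\<delta> / 2) (\<delta> * \<theta> / 4)"
  have \<epsilon>: "0 < \<epsilon>" "\<epsilon> \<le> \<delta> / 2" "\<epsilon> \<le> \<delta> * \<theta> / 4" using \<delta> \<theta> by (auto simp: \<epsilon>_def)
  \<comment> \<open>\<open>M\<close> becomes a subspace dimension: the trace of a line-free set on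
    an \<open>M\<close>-dimensional subspace is line-free, hence of density at most
    \<open>\<delta> + \<epsilon>\<close>.\<close>
  obtain M where M: "\<And>I A. finite I \<Longrightarrow> M \<le> card I \<Longrightarrow> A \<subseteq> cube I ?K \<Longrightarrow> \<not> has_line ?K I A \<Longrightarrow>
      card A \<le> (\<delta> + \<epsilon>) * q ^ card I"
    using up[OF \<epsilon>(1)] unfolding line_free_bound_def q_def by blast
  have "0 \<le> \<delta> + \<epsilon>" using \<delta> \<epsilon> by simp
  from line_free_card_le[OF DHJ K(1,3) \<epsilon>(1) this, of M] obtain d where
    d: "\<And>I B. finite I \<Longrightarrow> d \<le> card I \<Longrightarrow> B \<subseteq> cube I ?K \<Longrightarrow> \<not> has_line ?K I B \<Longrightarrow>
    (\<forall>w. subspace_word ?K {..<M} I w \<longrightarrow> card {u \<in> cube {..<M} ?K. subst I w u \<in> B} \<le> (\<delta> + \<epsilon>) * q ^ M) \<Longrightarrow>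
    card B \<le> (\<delta> + \<epsilon>) * (q ^ card I -
         card {u \<in> cube I ?K. \<forall>a\<in>K. mrg {i \<in> I. u i = z} (\<lambda>_. a) u \<in> B}) + \<epsilon> * q ^ card I"
    unfolding q_def by meson
  from rich[THEN spec, of d] obtain N where
    N: "\<forall>(I :: nat set) Y A. finite I \<and> N \<le> card I \<and> finite (Y :: (nat \<Rightarrow> 'a) set) \<and> Y \<noteq> {} \<and>
    (\<forall>x\<in>cube I ?K. \<delta> / 2 * card Y \<le> card {y \<in> Y. x \<in> A y}) \<longrightarrow>
    (\<exists>J e. J \<subseteq> I \<and> d \<le> card J \<and> e \<in> cube (I - J) K \<and>
      \<theta> * real (card ?K) ^ card J * card Y \<le>
      (\<Sum>u\<in>cube J ?K.
         real (card {y \<in> Y. \<forall>a\<in>K. mrg J (mrg {i \<in> J. u i = z} (\<lambda>_. a) u) e \<in> A y})))" ..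
  \<comment> \<open>If all \<open>q ^ N\<close> fibres have density at most
    \<open>\<delta> + \<epsilon>'\<close> and the average exceeds
    \<open>\<delta> - \<epsilon>'\<close>, no fibre falls short of \<delta> by more than
    \<open>2 * \<epsilon>' * q ^ N = \<epsilon>\<close>.\<close>
  define \<epsilon>' where "\<epsilon>' = \<epsilon> / (2 * q ^ N)"
  have \<epsilon>': "0 < \<epsilon>'" using \<epsilon> q by (simp add: \<epsilon>'_def)
  obtain n2 where n2: "\<And>I A. finite I \<Longrightarrow> n2 \<le> card I \<Longrightarrow> A \<subseteq> cube I ?K \<Longrightarrow> \<not> has_line ?K I A \<Longrightarrow>
      card A \<le> (\<delta> + \<epsilon>') * q ^ card I"
    using up[OF \<epsilon>'] unfolding line_free_bound_def q_def by blast
  obtain I A where I: "finite I" "N + n2 \<le> card I" and A: "A \<subseteq> cube I ?K" "\<not> has_line ?K I A"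
    and dense: "(\<delta> - \<epsilon>') * q ^ card I < card A"
    using low[OF \<epsilon>'] unfolding line_free_bound_def q_def not_ex not_all not_imp not_le conj_assoc
    by meson
  \<comment> \<open>Lines are sought in the coordinates \<open>I1\<close>; the points over
    \<open>I - I1\<close> play the part of the index set \<open>Y\<close> in the choice of
    \<open>N\<close>.\<close>
  obtain I1 where I1: "I1 \<subseteq> I" "card I1 = N" "finite I1"
    using obtain_subset_with_card_n[of N I] I by auto
  let ?X = "cube I1 ?K" and ?Y = "cube (I - I1) ?K"
  have I2: "finite (I - I1)" "n2 \<le> card (I - I1)" using I I1 by (auto simp: card_Diff_subset)
  have fin: "finite ?X" "finite ?Y" using I1 I2 K by (auto intro!: finite_cube)
  have Yne: "?Y \<noteq> {}" by (auto simp: PiE_eq_empty_iff)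
  define Q where "Q = q ^ card (I - I1)"
  have Q: "1 \<le> Q" using q by (simp add: Q_def)
  have cX: "real (card ?X) = q ^ N" and cY: "real (card ?Y) = Q"
    using card_cube[OF I1(3), of ?K] card_cube[OF I2(1), of ?K] I1(2) by (simp_all add: q_def Q_def)
  define f where "f x = real (card {y \<in> ?Y. mrg I1 x y \<in> A})" for x
  have f_le: "f x \<le> (\<delta> + \<epsilon>') * Q" if x: "x \<in> ?X" for x
    unfolding f_def Q_def
  proof (rule n2[OF I2])
    have "{y \<in> ?Y. mrg I1 x y \<in> A} = {y \<in> ?Y. mrg (I - I1) y x \<in> A}"
      using mrg_commute[OF I1(1) x] by auto
    then show "\<not> has_line ?K (I - I1) {y \<in> ?Y. mrg I1 x y \<in> A}"
      using A(2) has_line_fibre[of ?K "I - I1" x A I] by auto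
  qed auto
  have f_ge: "(\<delta> - \<epsilon>) * Q \<le> f x" if x: "x \<in> ?X" for x
  proof -
    have "(\<delta> - \<epsilon>') * (q ^ N * Q) < card A"
      using dense card_cube_split[OF I1(1) I(1), of ?K] I1(2) by (simp add: q_def Q_def)
    also have "real (card A) = (\<Sum>x\<in>?X. f x)"
      unfolding f_def using K by (intro card_cube_fibres(1) I1 I A) auto
    also have "\<dots> = f x + (\<Sum>x\<in>?X - {x}. f x)" using x fin by (intro sum.remove)
    also have "(\<Sum>x\<in>?X - {x}. f x) \<le> (\<Sum>x\<in>?X - {x}. (\<delta> + \<epsilon>') * Q)"
      by (intro sum_mono f_le) auto
    also have "\<dots> = (q ^ N - 1) * ((\<delta> + \<epsilon>') * Q)"
    proof -
      have "1 \<le> card ?X" using x fin by (auto simp: Suc_le_eq card_gt_0_iff simp del: card_PiE)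
      then have "real (card (?X - {x})) = q ^ N - 1"
        using x cX by (simp add: of_nat_diff del: card_PiE)
      then show ?thesis by simp
    qed
    finally have "(\<delta> - 2 * \<epsilon>' * q ^ N + \<epsilon>') * Q < f x" by (simp add: algebra_simps)
    moreover have "2 * \<epsilon>' * q ^ N = \<epsilon>" using q by (simp add: \<epsilon>'_def)
    moreover have "(\<delta> - \<epsilon>) * Q \<le> (\<delta> - \<epsilon> + \<epsilon>') * Q" using Q \<epsilon>' by (intro mult_right_mono) auto
    ultimately show ?thesis by simp
  qed
  define B0 where "B0 y = {x \<in> ?X. mrg I1 x y \<in> A}" for y
  have "\<exists>J e. J \<subseteq> I1 \<and> d \<le> card J \<and> e \<in> cube (I1 - J) K \<and>
      \<theta> * real (card ?K) ^ card J * card ?Y \<le>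
      (\<Sum>u\<in>cube J ?K.
         real (card {y \<in> ?Y. \<forall>a\<in>K. mrg J (mrg {i \<in> J. u i = z} (\<lambda>_. a) u) e \<in> B0 y}))"
  proof (rule N[THEN spec, THEN spec, THEN spec, THEN mp], intro conjI ballI)
    fix x assume x: "x \<in> ?X"
    have "\<delta> / 2 * Q \<le> (\<delta> - \<epsilon>) * Q" using \<epsilon> Q by (intro mult_right_mono) auto
    also have "\<dots> \<le> f x" by (rule f_ge[OF x])
    also have "f x = card {y \<in> ?Y. x \<in> B0 y}" using x by (simp add: f_def B0_def)
    finally show "\<delta> / 2 * card ?Y \<le> card {y \<in> ?Y. x \<in> B0 y}" unfolding cY .
  qed (use I1 fin Yne in auto)
  then obtain J e where J: "J \<subseteq> I1" "d \<le> card J" and e: "e \<in> cube (I1 - J) K" and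
    \<theta>_le: "\<theta> * q ^ card J * Q \<le>
      (\<Sum>u\<in>cube J ?K.
         real (card {y \<in> ?Y. \<forall>a\<in>K. mrg J (mrg {i \<in> J. u i = z} (\<lambda>_. a) u) e \<in> B0 y}))"
    unfolding cY q_def by blast
  have e': "e \<in> cube (I1 - J) ?K" using e by (auto simp: PiE_iff)
  have finJ: "finite J" using J(1) I1(3) finite_subset by auto
  have finC: "finite (cube J ?K)" using finJ K by (intro finite_cube) auto
  define B where "B y = {u \<in> cube J ?K. mrg J u e \<in> B0 y}" for y
  define D where "D y = {u \<in> cube J ?K. \<forall>a\<in>K. mrg {i \<in> J. u i = z} (\<lambda>_. a) u \<in> B y}" for y
  have repl: "mrg {i \<in> J. u i = z} (\<lambda>_. a) u \<in> cube J ?K" if "u \<in> cube J ?K" "a \<in> K" for u a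
    using that by (auto simp: mrg_def PiE_iff extensional_def)
  have B_le: "card (B y) \<le> (\<delta> + \<epsilon>) * (q ^ card J - card (D y)) + \<epsilon> * q ^ card J" if y: "y \<in> ?Y" for y
    unfolding D_def
  proof (rule d[OF finJ J(2)])
    show "B y \<subseteq> cube J ?K" by (auto simp: B_def)
    have "mrg I1 (mrg J u e) y = mrg J u (mrg I1 e y)" for u
      using J(1) by (auto simp: mrg_def fun_eq_iff)
    then have "B y = {u \<in> cube J ?K. mrg J u (mrg I1 e y) \<in> A}"
      using mrg_in_cube[OF J(1) _ e'] by (auto simp: B_def B0_def)
    then show lf: "\<not> has_line ?K J (B y)"
      using has_line_fibre[of ?K J "mrg I1 e y" A I] J(1) I1(1) A(2) by auto
    show "\<forall>w. subspace_word ?K {..<M} J w \<longrightarrow>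
        card {u \<in> cube {..<M} ?K. subst J w u \<in> B y} \<le> (\<delta> + \<epsilon>) * q ^ M"
    proof (intro allI impI)
      fix w assume w: "subspace_word ?K {..<M} J w"
      have "card {u \<in> cube {..<M} ?K. subst J w u \<in> B y} \<le> (\<delta> + \<epsilon>) * q ^ card {..<M}"
        using has_line_subst[OF _ w, of "B y"] lf by (intro M) auto
      then show "card {u \<in> cube {..<M} ?K. subst J w u \<in> B y} \<le> (\<delta> + \<epsilon>) * q ^ M" by simp
    qed
  qed
  define W where "W = q ^ card J * Q"
  have W: "0 < W" using q Q by (simp add: W_def)
  have "\<theta> * W \<le> (\<Sum>u\<in>cube J ?K.
         real (card {y \<in> ?Y. \<forall>a\<in>K. mrg J (mrg {i \<in> J. u i = z} (\<lambda>_. a) u) e \<in> B0 y}))"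
    using \<theta>_le by (simp add: W_def mult.assoc)
  also have "\<dots> = (\<Sum>y\<in>?Y. real (card {u \<in> cube J ?K. \<forall>a\<in>K. mrg J (mrg {i \<in> J. u i = z} (\<lambda>_. a) u) e \<in> B0 y}))"
    unfolding card_Collect_eq_sum_of_bool[OF fin(2)] card_Collect_eq_sum_of_bool[OF finC]
    by (rule sum.swap)
  also have "\<dots> = (\<Sum>y\<in>?Y. real (card (D y)))"
  proof -
    have "{u \<in> cube J ?K. \<forall>a\<in>K. mrg J (mrg {i \<in> J. u i = z} (\<lambda>_. a) u) e \<in> B0 y} = D y" for y
      using repl by (auto simp: D_def B_def)
    then show ?thesis by simp
  qed
  finally have D_ge: "\<theta> * W \<le> (\<Sum>y\<in>?Y. real (card (D y)))" .
  \<comment> \<open>The points of \<open>A\<close> over the fibre given by \<open>e\<close> are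
    estimated in two ways: from below by \<open>f_ge\<close>, and from above by \<open>B_le\<close>,
    where the proportion \<theta> filled by the sets \<open>D y\<close> is lost.\<close>
  have "(\<delta> - \<epsilon>) * W = (\<Sum>u\<in>cube J ?K. (\<delta> - \<epsilon>) * Q)"
    using card_cube[OF finJ, of ?K] by (simp add: W_def q_def del: card_PiE)
  also have "\<dots> \<le> (\<Sum>u\<in>cube J ?K. f (mrg J u e))"
    using mrg_in_cube[OF J(1) _ e'] by (intro sum_mono f_ge) auto
  also have "\<dots> = (\<Sum>u\<in>cube J ?K. real (card {y \<in> ?Y. mrg J u e \<in> B0 y}))"
    using mrg_in_cube[OF J(1) _ e'] by (intro sum.cong) (auto simp: f_def B0_def)
  also have "\<dots> = (\<Sum>y\<in>?Y. real (card (B y)))"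
    unfolding B_def card_Collect_eq_sum_of_bool[OF fin(2)] card_Collect_eq_sum_of_bool[OF finC]
    by (rule sum.swap)
  also have "\<dots> \<le> (\<Sum>y\<in>?Y. (\<delta> + \<epsilon>) * (q ^ card J - card (D y)) + \<epsilon> * q ^ card J)"
    by (intro sum_mono B_le)
  also have "\<dots> = (\<delta> + \<epsilon>) * (W - (\<Sum>y\<in>?Y. real (card (D y)))) + \<epsilon> * W"
    using cY by (simp add: sum.distrib sum_subtractf W_def mult.commute del: card_PiE flip: sum_distrib_left)
  also have "\<dots> \<le> (\<delta> + \<epsilon>) * (W - \<theta> * W) + \<epsilon> * W"
    using D_ge \<delta> \<epsilon> by (intro add_right_mono mult_left_mono) auto
  also have "\<dots> = ((\<delta> + \<epsilon>) * (1 - \<theta>) + \<epsilon>) * W" by (simp add: algebra_simps)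
  finally have "\<delta> - \<epsilon> \<le> (\<delta> + \<epsilon>) * (1 - \<theta>) + \<epsilon>" using W by simp
  then have "\<delta> * \<theta> + \<epsilon> * \<theta> \<le> 3 * \<epsilon>" by (simp add: algebra_simps)
  moreover have "0 < \<delta> * \<theta>" "0 < \<epsilon> * \<theta>" using \<delta> \<epsilon> \<theta> by auto
  ultimately show False using \<epsilon>(3) by linarith
qed

text \<open>With a single letter every point of the cube is a whole line, all of whose coordinates
  are active; the bound 1 guarantees that there are coordinates.\<close>

lemma DHJ_singleton: "DHJ {a}"
  unfolding DHJ_def
proof (intro allI impI exI[of _ 1], elim conjE)
  fix \<delta> :: real and I :: "nat set" and A
  assume "0 < \<delta>" "finite I" "1 \<le> card I" "A \<subseteq> cube I {a}" "\<delta> * real (card {a}) ^ card I \<le> card A"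
  then have "A \<noteq> {}" "I \<noteq> {}" by auto
  then obtain x where x: "x \<in> A" by blast
  then have "x \<in> cube I {a}" using \<open>A \<subseteq> cube I {a}\<close> by blast
  then have "mrg I (\<lambda>_. b) x = x" if "b \<in> {a}" for b
    using that by (auto simp: mrg_def fun_eq_iff PiE_iff)
  then show "has_line {a} I A"
    unfolding has_line_def using x \<open>I \<noteq> {}\<close> by (intro exI[of _ I] exI[of _ x]) simp
qed

theorem density_Hales_Jewett:
  assumes "finite K" "K \<noteq> {}"
  shows "DHJ K"
  using assms by (induction K rule: finite_ne_induct) (auto intro: DHJ_singleton DHJ_insert)

section \<open>IP-systems and D-sets\<close>

lemma upper_banach_density_pos:
  assumes "0 < upper_banach_density E"
  shows "\<exists>\<delta>>0. \<forall>L. \<exists>n m. 1 \<le> n \<and> n < m \<and> L \<le> m - n \<and>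
           \<delta> * (real m - real n + 1) \<le> card (E \<inter> {n..m})"
proof -
  let ?f = "\<lambda>(n, m). ereal (real (card (E \<inter> {n..m})) / (real m - real n + 1))"
  obtain c where c: "0 < c" "ereal c < upper_banach_density E"
    using ereal_dense2[OF assms] by auto
  have "\<exists>n m. 1 \<le> n \<and> n < m \<and> L \<le> m - n \<and> c * (real m - real n + 1) \<le> card (E \<inter> {n..m})" for L
  proof (rule ccontr)
    assume neg: "\<not> ?thesis"
    \<comment> \<open>\<open>Suc L\<close> instead of \<open>L\<close> excludes
      \<open>m \<le> n\<close>, where the truncated difference vanishes.\<close>
    have "?f (n, m) \<le> ereal c" if "1 \<le> n" "Suc L \<le> m - n" for n m
    proof -
      have "n < m" "L \<le> m - n" using that by auto
      then have "card (E \<inter> {n..m}) \<le> c * (real m - real n + 1)"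
        using neg that by (meson le_cases)
      then show ?thesis using \<open>n < m\<close> by (simp add: divide_le_eq)
    qed
    then have "eventually (\<lambda>x. ?f x \<le> ereal c) interval_length_filter"
      unfolding interval_length_filter_def eventually_inf_principal eventually_filtercomap_at_top_linorder
      by (intro exI[of _ "Suc L"]) auto
    then have "upper_banach_density E \<le> ereal c"
      unfolding upper_banach_density_def by (rule Limsup_bounded)
    with c show False by simp
  qed
  with c(1) show ?thesis by blast
qed

text \<open>Summing \<open>t (w k) k\<close> sends a word \<open>w\<close> to an integer
  \<open>\<sigma> w\<close>. Averaging over translates yields an \<open>a\<close> with
  \<open>a + \<sigma> w\<close> in \<open>E\<close> for many words \<open>w\<close>; on a line of
  such words the inactive coordinates add a constant to \<open>a\<close>, and the active ones form
  \<alpha>.\<close>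

lemma ip_Szemeredi:
  fixes t :: "nat \<Rightarrow> nat \<Rightarrow> int"
  assumes E: "0 < upper_banach_density E" and p: "1 \<le> p"
  shows "\<exists>a \<alpha>. 1 \<le> a \<and> \<alpha> \<in> fin_sets \<and> L < Min \<alpha> \<and>
    (\<forall>i\<in>{1..p}. int a + (\<Sum>k\<in>\<alpha>. t i k) \<in> int ` E)"
proof -
  obtain \<delta> where \<delta>: "0 < \<delta>" and dense: "\<And>L. \<exists>n m. 1 \<le> n \<and> n < m \<and> L \<le> m - n \<and>
           \<delta> * (real m - real n + 1) \<le> card (E \<inter> {n..m})"
    using upper_banach_density_pos[OF E] by blast
  have "DHJ {1..p}" using p by (intro density_Hales_Jewett) auto
  moreover have "0 < \<delta> / 4" using \<delta> by simp
  ultimately obtain N where N: "\<And>I A. finite I \<Longrightarrow> N \<le> card I \<Longrightarrow> A \<subseteq> cube I {1..p} \<Longrightarrow>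
     \<delta> / 4 * real (card {1..p}) ^ card I \<le> card A \<Longrightarrow> has_line {1..p} I A"
    unfolding DHJ_def by meson
  \<comment> \<open>Coordinates beyond \<open>L\<close> give
    \<open>L < Min \<alpha>\<close>.\<close>
  define I where "I = {L<..L + N}"
  have I: "finite I" "card I = N" by (auto simp: I_def)
  let ?C = "cube I {1..p}"
  define P where "P = real (card ?C)"
  have finC: "finite ?C" using I by (intro finite_cube) auto
  have "?C \<noteq> {}" using p by (auto simp: PiE_eq_empty_iff)
  then have P: "0 < P" using finC by (simp add: P_def card_gt_0_iff del: card_PiE)
  define \<sigma> where "\<sigma> w = (\<Sum>k\<in>I. t (w k) k)" for w
  \<comment> \<open>Bounds the absolute value of every partial sum along any word.\<close>
  define c where "c = (\<Sum>k\<in>I. \<Sum>i\<in>{1..p}. \<bar>t i k\<bar>)"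
  have c0: "0 \<le> c" unfolding c_def by (intro sum_nonneg) auto
  have t_le: "\<bar>t i k\<bar> \<le> (\<Sum>i\<in>{1..p}. \<bar>t i k\<bar>)" if "i \<in> {1..p}" for i k
    using that by (intro member_le_sum) auto
  have part_le: "\<bar>\<Sum>k\<in>S. t (w k) k\<bar> \<le> c" if "S \<subseteq> I" "\<And>k. k \<in> S \<Longrightarrow> w k \<in> {1..p}" for S w
  proof -
    have "\<bar>\<Sum>k\<in>S. t (w k) k\<bar> \<le> (\<Sum>k\<in>S. \<bar>t (w k) k\<bar>)" by (rule sum_abs)
    also have "\<dots> \<le> (\<Sum>k\<in>S. \<Sum>i\<in>{1..p}. \<bar>t i k\<bar>)" using that by (intro sum_mono t_le) auto
    also have "\<dots> \<le> c" unfolding c_def using that I by (intro sum_mono2) (auto intro: sum_nonneg)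
    finally show ?thesis .
  qed
  \<comment> \<open>A length of at least \<open>2 * c / \<delta>\<close> makes trimming by
    \<open>c\<close> cost at most half of the density, and a length of at least \<open>2 * c\<close>
    keeps the range \<open>B\<close> of translates within twice the interval; together this leaves
    \<open>\<delta> / 4\<close>.\<close>
  obtain n m where nm: "1 \<le> n" "n < m" "nat (2 * c) + nat \<lceil>2 * c / \<delta>\<rceil> \<le> m - n"
    and En: "\<delta> * (real m - real n + 1) \<le> card (E \<inter> {n..m})"
    using dense[of "nat (2 * c) + nat \<lceil>2 * c / \<delta>\<rceil>"] by blast
  define len where "len = real m - real n + 1"
  have len: "0 < len" "2 * real_of_int c \<le> len" "2 * real_of_int c / \<delta> \<le> len"
  proof -
    show "0 < len" using nm by (simp add: len_def)
    have *: "real (nat (2 * c)) + real (nat \<lceil>2 * c / \<delta>\<rceil>) \<le> len"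
      using nm by (simp add: len_def)
    have "2 * real_of_int c / \<delta> \<le> real (nat \<lceil>2 * c / \<delta>\<rceil>)" by linarith
    then show "2 * real_of_int c / \<delta> \<le> len" using * by linarith
    have "2 * real_of_int c \<le> real (nat (2 * c))" using c0 by simp
    then show "2 * real_of_int c \<le> len" using * by linarith
  qed
  \<comment> \<open>The first \<open>c\<close> places are dropped so that \<open>a'\<close>, at
    distance at most \<open>c\<close> from a point of \<open>E'\<close>, is still positive.\<close>
  define E' where "E' = int ` (E \<inter> {n + nat c..m})"
  have finE': "finite E'" by (simp add: E'_def)
  have E'_ge: "\<delta> / 2 * len \<le> card E'"
  proof -
    have "card (E \<inter> {n..m}) \<le> card ((E \<inter> {n + nat c..m}) \<union> {n..<n + nat c})"
      by (intro card_mono) auto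
    also have "\<dots> \<le> card (E \<inter> {n + nat c..m}) + nat c"
      using card_Un_le[of "E \<inter> {n + nat c..m}" "{n..<n + nat c}"] by simp
    also have "card (E \<inter> {n + nat c..m}) = card E'" unfolding E'_def by (simp add: card_image)
    finally have "real (card (E \<inter> {n..m})) \<le> card E' + real_of_int c" using c0 by linarith
    moreover have "real_of_int c \<le> \<delta> / 2 * len" using len(3) \<delta> by (simp add: field_simps)
    ultimately show ?thesis using En unfolding len_def by linarith
  qed
  define B where "B = {int n - c..int m + c}"
  have finB: "finite B" by (simp add: B_def)
  have cB: "real (card B) \<le> 2 * len"
  proof -
    have "real (card B) = real_of_int (int m + c - (int n - c) + 1)"
      using nm c0 by (simp add: B_def)
    also have "\<dots> = len + 2 * real_of_int c" by (simp add: len_def)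
    finally show ?thesis using len by linarith
  qed
  have Bne: "B \<noteq> {}" using nm c0 by (auto simp: B_def)
  have shift: "card {a \<in> B. a + \<sigma> w \<in> E'} = card E'" if w: "w \<in> ?C" for w
  proof -
    have "\<bar>\<sigma> w\<bar> \<le> c" unfolding \<sigma>_def using w by (intro part_le) auto
    then have "{a \<in> B. a + \<sigma> w \<in> E'} = (\<lambda>e. e - \<sigma> w) ` E'"
      by (force simp: B_def E'_def image_iff)
    then show ?thesis by (simp add: card_image inj_on_def)
  qed
  have "\<exists>a\<in>B. \<delta> / 4 * P \<le> card {w \<in> ?C. a + \<sigma> w \<in> E'}"
  proof (rule ccontr)
    assume neg: "\<not> ?thesis"
    have "P * (\<delta> / 2 * len) \<le> P * card E'" using E'_ge P by (intro mult_left_mono) auto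
    also have "\<dots> = (\<Sum>w\<in>?C. real (card {a \<in> B. a + \<sigma> w \<in> E'}))"
      by (simp add: shift P_def del: card_PiE)
    also have "\<dots> = (\<Sum>a\<in>B. real (card {w \<in> ?C. a + \<sigma> w \<in> E'}))"
      unfolding card_Collect_eq_sum_of_bool[OF finB] card_Collect_eq_sum_of_bool[OF finC]
      by (rule sum.swap)
    also have "\<dots> < (\<Sum>a\<in>B. \<delta> / 4 * P)"
      using neg finB Bne by (intro sum_strict_mono) (auto simp: not_le)
    also have "\<dots> \<le> 2 * len * (\<delta> / 4 * P)" using cB \<delta> P by (simp add: mult_right_mono)
    finally show False by (simp add: algebra_simps)
  qed
  then obtain a where a: "\<delta> / 4 * P \<le> card {w \<in> ?C. a + \<sigma> w \<in> E'}" by blast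
  have "has_line {1..p} I {w \<in> ?C. a + \<sigma> w \<in> E'}"
    using a I card_cube[OF I(1), of "{1..p}"] unfolding P_def by (intro N) auto
  then obtain S x where S: "S \<subseteq> I" "S \<noteq> {}" and
    line: "\<And>i. i \<in> {1..p} \<Longrightarrow> mrg S (\<lambda>_. i) x \<in> ?C \<and> a + \<sigma> (mrg S (\<lambda>_. i) x) \<in> E'"
    unfolding has_line_def by blast
  define a' where "a' = a + (\<Sum>k\<in>I - S. t (x k) k)"
  have finS: "finite S" using S I finite_subset by auto
  have in_E: "a' + (\<Sum>k\<in>S. t i k) \<in> E'" if i: "i \<in> {1..p}" for i
  proof -
    have "\<sigma> (mrg S (\<lambda>_. i) x) = (\<Sum>k\<in>I - S. t (x k) k) + (\<Sum>k\<in>S. t i k)"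
      unfolding \<sigma>_def sum.subset_diff[OF S(1) I(1)]
      by (intro arg_cong2[where f = "(+)"] sum.cong) (auto simp: mrg_def)
    then show ?thesis using line[OF i] by (simp add: a'_def add.assoc)
  qed
  have "1 \<le> a'"
  proof -
    have 1: "1 \<in> {1..p}" using p by simp
    have "\<bar>\<Sum>k\<in>S. t 1 k\<bar> \<le> c" using part_le[OF S(1), of "\<lambda>_. 1"] p by simp
    moreover have "int n + c \<le> a' + (\<Sum>k\<in>S. t 1 k)" using in_E[OF 1] c0 by (auto simp: E'_def)
    ultimately show ?thesis using nm by linarith
  qed
  moreover have "S \<in> fin_sets" using finS S by (auto simp: fin_sets_def I_def)
  moreover have "L < Min S" using finS S by (auto simp: I_def)
  moreover have "E' \<subseteq> int ` E" by (auto simp: E'_def)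
  ultimately show ?thesis
    using in_E by (intro exI[of _ "nat a'"] exI[of _ S]) auto
qed

section \<open>Simultaneous returns along IP-systems\<close>

lemma openin_funpow_preimage:
  assumes "dynamical_system X T" "openin (top_of_set X) V"
  shows "openin (top_of_set X) (X \<inter> (T ^^ n) -` V)"
proof -
  have T: "continuous_on X T" "T ` X \<subseteq> X" using assms(1) by (auto simp: dynamical_system_def)
  have "continuous_on X (T ^^ n) \<and> (T ^^ n) ` X \<subseteq> X"
  proof (induction n)
    case (Suc n)
    then show ?case using T continuous_on_compose2[OF T(1), of X "T ^^ n"] by (auto simp: comp_def)
  qed auto
  then show ?thesis
    using assms(2) by (intro continuous_openin_preimage[where T = X]) auto
qed

text \<open>The density theorem is applied to \<open>y\<close> alone. One entry time
  \<open>n\<close> of the pair into \<open>W \<times> W\<close> serves all \<open>i\<close> at once,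
  so it can be added to \<open>a\<close> while \<alpha> stays the same.\<close>

lemma ip_return:
  fixes t :: "nat \<Rightarrow> nat \<Rightarrow> int"
  assumes X: "dynamical_system X T" "x \<in> X" "y \<in> X" and y: "essentially_recurrent X T y"
    and xy: "(y, y) \<in> orbit_closure (X \<times> X) (map_prod T T) (x, y)"
    and V: "openin (top_of_set X) V" "y \<in> V" and p: "1 \<le> p"
  shows "\<exists>a \<alpha>. 1 \<le> a \<and> \<alpha> \<in> fin_sets \<and> L < Min \<alpha> \<and>
    (\<forall>i\<in>{1..p}. \<exists>r\<ge>1. int r = int a + (\<Sum>k\<in>\<alpha>. t i k) \<and> (T ^^ r) x \<in> V \<and> (T ^^ r) y \<in> V)"
proof -
  have "V \<subseteq> X" using V by (auto simp: openin_subset dest: openin_imp_subset)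
  moreover have "y \<in> top_of_set X interior_of V" using V by (simp add: interior_of_openin)
  ultimately have "0 < upper_banach_density {n. n \<ge> 1 \<and> (T ^^ n) y \<in> V}"
    using y by (simp add: essentially_recurrent_def)
  from ip_Szemeredi[OF this p, of L t] obtain c \<alpha> where \<alpha>: "1 \<le> c" "\<alpha> \<in> fin_sets" "L < Min \<alpha>"
    and ret: "\<forall>i\<in>{1..p}. \<exists>r. 1 \<le> r \<and> (T ^^ r) y \<in> V \<and> int c + (\<Sum>k\<in>\<alpha>. t i k) = int r"
    by (auto simp: image_iff)
  then obtain r where r: "\<And>i. i \<in> {1..p} \<Longrightarrow> 1 \<le> r i \<and> (T ^^ r i) y \<in> V \<and> int c + (\<Sum>k\<in>\<alpha>. t i k) = int (r i)"
    by metis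
  define W where "W = (\<Inter>i\<in>{1..p}. X \<inter> (T ^^ r i) -` V)"
  have "openin (top_of_set X) W"
    unfolding W_def
  proof (rule openin_INT2)
    show "openin (top_of_set X) (X \<inter> (T ^^ r i) -` V)" for i
      by (rule openin_funpow_preimage[OF X(1) V(1)])
  qed (use p in auto)
  moreover have "y \<in> W" using X r by (auto simp: W_def)
  ultimately have "openin (top_of_set (X \<times> X)) (W \<times> W)" "(y, y) \<in> W \<times> W"
    by (auto intro: openin_Times)
  then have "\<exists>q. q \<in> {(map_prod T T ^^ n) (x, y) |n. n \<ge> 1} \<and> q \<in> W \<times> W"
    using xy[unfolded orbit_closure_def in_closure_of, THEN conjunct2, THEN spec, of "W \<times> W"]
    by simp
  then obtain n where n: "1 \<le> n" "(map_prod T T ^^ n) (x, y) \<in> W \<times> W"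
    by (elim exE conjE CollectE) (rule that, simp_all)
  have "(map_prod T T ^^ n) (x, y) = ((T ^^ n) x, (T ^^ n) y)" by (induction n) auto
  then have W: "(T ^^ n) x \<in> W" "(T ^^ n) y \<in> W" using n by auto
  have "\<exists>r\<ge>1. int r = int (c + n) + (\<Sum>k\<in>\<alpha>. t i k) \<and> (T ^^ r) x \<in> V \<and> (T ^^ r) y \<in> V"
    if i: "i \<in> {1..p}" for i
    using W i r[OF i] by (intro exI[of _ "r i + n"]) (auto simp: W_def funpow_add)
  then show ?thesis using \<alpha> by (intro exI[of _ "c + n"] exI[of _ \<alpha>]) auto
qed

theorem theorem10:
  fixes S :: "nat set" and p :: nat and s :: "nat \<Rightarrow> nat set \<Rightarrow> int"
  assumes "D_set TYPE('a::metric_space) S"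
    and "p \<ge> 1"
    and "\<And>i. i \<in> {1..p} \<Longrightarrow> ip_system (s i)"
  shows "\<exists>(a :: nat \<Rightarrow> nat) (\<alpha> :: nat \<Rightarrow> nat set).
           (\<forall>k\<ge>1. a k \<ge> 1) \<and>
           (\<forall>k\<ge>1. \<alpha> k \<in> fin_sets) \<and>
           (\<forall>k\<ge>1. \<alpha> k \<lless> \<alpha> (Suc k)) \<and>
           (\<forall>K\<in>fin_sets. \<forall>i\<in>{1..p}. (\<Sum>k\<in>K. int (a k) + s i (\<alpha> k)) \<in> int ` S)"
proof -
  obtain X :: "'a set" and T x y U where X: "dynamical_system X T" "x \<in> X" "y \<in> X"
    and y: "essentially_recurrent X T y"
    and xy: "(y, y) \<in> orbit_closure (X \<times> X) (map_prod T T) (x, y)"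
    and U: "openin (top_of_set (X \<times> X)) U" "(y, y) \<in> U"
    and S: "S = {n. n \<ge> 1 \<and> ((T ^^ n) x, (T ^^ n) y) \<in> U}"
    using assms(1) unfolding D_set_def by blast
  obtain t :: "nat \<Rightarrow> nat \<Rightarrow> int" where
    t: "\<And>i \<alpha>. i \<in> {1..p} \<Longrightarrow> \<alpha> \<in> fin_sets \<Longrightarrow> s i \<alpha> = (\<Sum>k\<in>\<alpha>. t i k)"
    using assms(3) unfolding ip_system_def by metis
  obtain O' where O': "open O'" "U = X \<times> X \<inter> O'" using U(1) by (auto simp: openin_open)
  then obtain A B where AB: "open A" "open B" "(y, y) \<in> A \<times> B" "A \<times> B \<subseteq> O'"
    using U(2) by (auto elim: open_prod_elim)
  \<comment> \<open>A square neighbourhood splits membership in \<open>U\<close> into separate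
    conditions on \<open>x\<close> and \<open>y\<close>.\<close>
  define V where "V = X \<inter> (A \<inter> B)"
  have V: "openin (top_of_set X) V" "y \<in> V" "V \<times> V \<subseteq> U"
    using AB O' X by (auto simp: V_def openin_open)
  \<comment> \<open>\<open>R i\<close> will contain every finite sum formed so far for the index
    \<open>i\<close>; \<open>ext\<close> demands that the new term and its sums with all old ones
    are recorded.\<close>
  define good where "good R \<longleftrightarrow> finite R \<and> (\<forall>r\<in>R. 1 \<le> r \<and> (T ^^ r) x \<in> V \<and> (T ^^ r) y \<in> V)" for R
  define ext where "ext R r R' \<longleftrightarrow> r \<in> R' \<and> R \<subseteq> R' \<and> (\<lambda>n. r + n) ` R \<subseteq> R'" for R R' :: "nat set" and r
  have step: "\<exists>a \<alpha> R'. 1 \<le> a \<and> \<alpha> \<in> fin_sets \<and> L < Min \<alpha> \<and>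
      (\<forall>i\<in>{1..p}. good (R' i) \<and> (\<exists>r. int r = int a + s i \<alpha> \<and> ext (R i) r (R' i)))"
    if R: "\<forall>i\<in>{1..p}. good (R i)" for R :: "nat \<Rightarrow> nat set" and L
  proof -
    define R0 where "R0 = (\<Union>i\<in>{1..p}. R i)"
    have "finite R0"
      using R finite_UN_I[of "{1..p}" R] unfolding R0_def good_def by blast
    moreover have "(T ^^ r) y \<in> V" if "r \<in> R0" for r
      using that R unfolding R0_def good_def by blast
    ultimately have R0: "finite R0" "\<And>r. r \<in> R0 \<Longrightarrow> (T ^^ r) y \<in> V" by blast+
    \<comment> \<open>Points of \<open>W\<close> are carried into \<open>V\<close> by every sum
      formed so far, so a new term followed by an old sum ends in \<open>V\<close>. The time 0 keeps
      the index set nonempty in the first step, where \<open>R0\<close> is empty.\<close>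
    define W where "W = V \<inter> (\<Inter>r\<in>insert 0 R0. X \<inter> (T ^^ r) -` V)"
    have "openin (top_of_set X) (\<Inter>r\<in>insert 0 R0. X \<inter> (T ^^ r) -` V)"
    proof (rule openin_INT2)
      show "openin (top_of_set X) (X \<inter> (T ^^ r) -` V)" for r
        by (rule openin_funpow_preimage[OF X(1) V(1)])
    qed (use R0 in auto)
    then have W: "openin (top_of_set X) W" unfolding W_def using V(1) by (rule openin_Int[rotated])
    have yW: "y \<in> W" using V X R0 by (auto simp: W_def)
    obtain a \<alpha> where a: "1 \<le> a" "\<alpha> \<in> fin_sets" "L < Min \<alpha>" and
      ret: "\<forall>i\<in>{1..p}. \<exists>r\<ge>1. int r = int a + (\<Sum>k\<in>\<alpha>. t i k) \<and> (T ^^ r) x \<in> W \<and> (T ^^ r) y \<in> W"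
      using ip_return[OF X y xy W yW assms(2), of L t] by blast
    obtain r where r: "\<And>i. i \<in> {1..p} \<Longrightarrow> 1 \<le> r i \<and> int (r i) = int a + s i \<alpha> \<and>
        (T ^^ r i) x \<in> W \<and> (T ^^ r i) y \<in> W"
      using ret t[OF _ a(2)] by metis
    define R' where "R' i = insert (r i) (R i \<union> (\<lambda>n. r i + n) ` R i)" for i
    have "good (R' i)" if i: "i \<in> {1..p}" for i
    proof -
      have "(T ^^ (r i + n)) x \<in> V \<and> (T ^^ (r i + n)) y \<in> V" if "n \<in> R i" for n
      proof -
        have "n \<in> R0" using that i by (auto simp: R0_def)
        then have "(T ^^ (n + r i)) x \<in> V \<and> (T ^^ (n + r i)) y \<in> V"
          using r[OF i] by (auto simp: W_def funpow_add split: if_splits)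
        then show ?thesis by (simp add: add.commute)
      qed
      moreover have "(T ^^ r i) x \<in> V" "(T ^^ r i) y \<in> V" "1 \<le> r i"
        using r[OF i] by (auto simp: W_def)
      moreover have "finite (R i)" "\<And>n. n \<in> R i \<Longrightarrow> 1 \<le> n \<and> (T ^^ n) x \<in> V \<and> (T ^^ n) y \<in> V"
        using R i unfolding good_def by blast+
      ultimately show ?thesis unfolding good_def R'_def by auto
    qed
    moreover have ext: "ext (R i) (r i) (R' i)" for i by (auto simp: ext_def R'_def)
    ultimately have "\<forall>i\<in>{1..p}. good (R' i) \<and> (\<exists>r. int r = int a + s i \<alpha> \<and> ext (R i) r (R' i))"
    proof (intro ballI conjI)
      fix i assume i: "i \<in> {1..p}"
      then have "int (r i) = int a + s i \<alpha>" using r by blast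
      then show "\<exists>r. int r = int a + s i \<alpha> \<and> ext (R i) r (R' i)"
        using ext[of i] by blast
    qed blast
    then show ?thesis using a by (intro exI[of _ a] exI[of _ \<alpha>] exI[of _ R'] conjI)
  qed
  define P where "P q \<longleftrightarrow> (case q of (a, \<alpha>, R) \<Rightarrow> 1 \<le> a \<and> \<alpha> \<in> fin_sets \<and> (\<forall>i\<in>{1..p}. good (R i)))"
    for q :: "nat \<times> nat set \<times> (nat \<Rightarrow> nat set)"
  define Q where "Q q q' \<longleftrightarrow> (case q of (a, \<alpha>, R) \<Rightarrow> case q' of (a', \<alpha>', R') \<Rightarrow> Max \<alpha> < Min \<alpha>' \<and>
      (\<forall>i\<in>{1..p}. \<exists>r. int r = int a' + s i \<alpha>' \<and> ext (R i) r (R' i)))"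
    for q q' :: "nat \<times> nat set \<times> (nat \<Rightarrow> nat set)"
  \<comment> \<open>The triple \<open>(0, {0}, \<lambda>_. {})\<close> is a fictitious predecessor
    of the first state: as \<open>Max {0} = 0\<close> and there are no earlier sums, it only asks
    that the first term be recorded.\<close>
  have "\<exists>f. \<forall>n. (P (f n) \<and> (n = 0 \<longrightarrow> Q (0, {0}, \<lambda>_. {}) (f n))) \<and> Q (f n) (f (Suc n))"
  proof (rule dependent_nat_choice[where P = "\<lambda>n q. P q \<and> (n = 0 \<longrightarrow> Q (0, {0}, \<lambda>_. {}) q)"
        and Q = "\<lambda>_. Q"])
    have "\<forall>i\<in>{1..p}. good {}" by (simp add: good_def)
    from step[OF this, of 0] show "\<exists>q. P q \<and> (0 = 0 \<longrightarrow> Q (0, {0}, \<lambda>_. {}) q)"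
      unfolding P_def Q_def by simp blast
  next
    fix q :: "nat \<times> nat set \<times> (nat \<Rightarrow> nat set)" and n :: nat
    obtain a \<alpha> R where q: "q = (a, \<alpha>, R)" by (cases q)
    assume "P q \<and> (n = 0 \<longrightarrow> Q (0, {0}, \<lambda>_. {}) q)"
    then have "\<forall>i\<in>{1..p}. good (R i)" by (simp add: P_def q)
    from step[OF this, of "Max \<alpha>"]
    show "\<exists>q'. (P q' \<and> (Suc n = 0 \<longrightarrow> Q (0, {0}, \<lambda>_. {}) q')) \<and> Q q q'"
      unfolding P_def Q_def q by simp blast
  qed
  then obtain f where f: "\<And>n. P (f n)" "Q (0, {0}, \<lambda>_. {}) (f 0)" "\<And>n. Q (f n) (f (Suc n))" by blast
  \<comment> \<open>The shift turns a recursion started at 0 into sequences indexed from 1.\<close>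
  define a where "a k = fst (f (k - 1))" for k
  define \<alpha> where "\<alpha> k = fst (snd (f (k - 1)))" for k
  define R where "R k = snd (snd (f (k - 1)))" for k
  have fk: "f n = (a (Suc n), \<alpha> (Suc n), R (Suc n))" for n by (simp add: a_def \<alpha>_def R_def)
  have Pk: "1 \<le> a (Suc n)" "\<alpha> (Suc n) \<in> fin_sets" "i \<in> {1..p} \<Longrightarrow> good (R (Suc n) i)" for n i
    using f(1)[of n] by (auto simp: P_def fk)
  have Q0: "i \<in> {1..p} \<Longrightarrow> \<exists>r. int r = int (a 1) + s i (\<alpha> 1) \<and> r \<in> R 1 i" for i
    using f(2) by (auto simp: Q_def fk ext_def)
  have Qk: "Max (\<alpha> (Suc n)) < Min (\<alpha> (Suc (Suc n)))"
    "i \<in> {1..p} \<Longrightarrow> \<exists>r. int r = int (a (Suc (Suc n))) + s i (\<alpha> (Suc (Suc n))) \<and>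
       ext (R (Suc n) i) r (R (Suc (Suc n)) i)" for n i
    using f(3)[of n] by (auto simp: Q_def fk)
  \<comment> \<open>Induction on the largest index allowed: its term is absent, stands alone or is
    added to an earlier sum, and \<open>ext\<close> covers each case.\<close>
  have sums: "K \<subseteq> {1..Suc n} \<Longrightarrow> K \<noteq> {} \<Longrightarrow> (\<Sum>k\<in>K. int (a k) + s i (\<alpha> k)) \<in> int ` R (Suc n) i"
    if i: "i \<in> {1..p}" for i n K
  proof (induction n arbitrary: K)
    case 0
    then have "K = {1}" by auto
    then show ?case using Q0[OF i] by (auto simp: image_iff) metis
  next
    case (Suc n)
    let ?k = "Suc (Suc n)"
    obtain r where r: "int r = int (a ?k) + s i (\<alpha> ?k)" "ext (R (Suc n) i) r (R ?k i)"
      using Qk(2)[OF i] by blast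
    define K' where "K' = K - {?k}"
    have K': "K' \<subseteq> {1..Suc n}" using Suc.prems by (auto simp: K'_def)
    have finK: "finite K" using Suc.prems finite_subset by blast
    show ?case
    proof (cases "?k \<in> K")
      case False
      then have "K' = K" by (simp add: K'_def)
      then show ?thesis using Suc.IH[OF K'] Suc.prems r(2) by (auto simp: ext_def)
    next
      case True
      then have sum: "(\<Sum>k\<in>K. int (a k) + s i (\<alpha> k)) = int r + (\<Sum>k\<in>K'. int (a k) + s i (\<alpha> k))"
        using finK r(1) by (simp add: sum.remove K'_def)
      show ?thesis
      proof (cases "K' = {}")
        case True
        then show ?thesis using r(2) unfolding sum by (auto simp: ext_def)
      next
        case False
        then obtain r' where "r' \<in> R (Suc n) i" "(\<Sum>k\<in>K'. int (a k) + s i (\<alpha> k)) = int r'"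
          using Suc.IH[OF K'] by auto
        then show ?thesis using r(2) unfolding sum by (auto simp: ext_def image_iff intro!: bexI[of _ "r + r'"])
      qed
    qed
  qed
  have "(\<Sum>k\<in>K. int (a k) + s i (\<alpha> k)) \<in> int ` S" if K: "K \<in> fin_sets" and i: "i \<in> {1..p}" for K i
  proof -
    have "K \<subseteq> {1..Suc (Max K)}" "K \<noteq> {}" using K by (auto simp: fin_sets_def le_Suc_eq)
    from sums[OF i this] obtain r where r: "r \<in> R (Suc (Max K)) i"
      "(\<Sum>k\<in>K. int (a k) + s i (\<alpha> k)) = int r" by auto
    then have "r \<in> S" using Pk(3)[OF i, of "Max K"] V(3) by (auto simp: S good_def)
    then show ?thesis using r by simp
  qed
  moreover have "1 \<le> a k" "\<alpha> k \<in> fin_sets" "\<alpha> k \<lless> \<alpha> (Suc k)" if "1 \<le> k" for k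
    using that Pk(1,2)[of "k - 1"] Qk(1)[of "k - 1"] by (auto simp: set_less_def)
  ultimately show ?thesis by (intro exI[of _ a] exI[of _ \<alpha>]) blast
qed

end
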